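(* Let $n,m\ge1$, let $F=F_1\times\cdots\times F_m$ be a product of $m$ regular distributions, and let $([m],\mathcal I)$ be a downward-closed set system with $\{j\}\in\mathcal I$ for every $j\in[m]$. Let $\mathrm{VCG}_n^{\mathrm{Add}}$ be the expected VCG revenue from selling the $m$ items to $n$ additive bidders whose item values are i.i.d. draws from $F$, and let $\mathrm{VCG}_{n'}^{\mathrm{DC}}$ be the expected VCG revenue from selling them to $n'$ bidders whose item values are i.i.d. draws from $F$ and whose valuations are all additive subject to $\mathcal I$. Then $$\mathrm{VCG}_{n+m-1}^{\mathrm{DC}}\ \ge\ \mathrm{VCG}_n^{\mathrm{Add}}.$$
   Context: Each $F_j$ on $[0,\infty)$ (identified with its CDF) is taken to be continuous, with density $f_j$ positive on an interval, and is regular if $\varphi_j(x)=x-\frac{1-F_j(x)}{f_j(x)}$ is non-decreasing. Bidder $i$ has item values $v_{ij}\sim F_j$, all independent. Downward-closed means $T\subseteq S\in\mathcal I$ implies $T\in\mathcal I$. A bidder additive subject to $\mathcal I$ has value $v_i(S)=\max_{T\subseteq S,\,T\in\mathcal I}\sum_{j\in T}v_{ij}$ for $S\subseteq[m]$; an additive bidder has $v_i(S)=\sum_{j\in S}v_{ij}$. VCG chooses a welfare-maximizing allocation (each item to at most one bidder) and charges each bidder her externality: the maximum welfare of the other bidders without her, minus the welfare of the others in the chosen allocation. *)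

theory Defs
  imports "HOL-Probability.Probability"
begin

section \<open>Regular distributions\<close>

definition virtual_value :: "real measure \<Rightarrow> (real \<Rightarrow> real) \<Rightarrow> real \<Rightarrow> real" where
  "virtual_value D f x = x - (1 - cdf D x) / f x"

text \<open>
  A distribution on the nonnegative reals is a measure, with distribution function \<open>cdf D\<close>;
  having a Lebesgue density, it has no atoms, so \<open>cdf D\<close> is continuous. The virtual value is
  meaningful only on the interval \<open>S\<close> where the density is positive, so monotonicity is required
  exactly there. A density is determined only up to null sets, so it is quantified
  existentially.
\<close>

definition regular_distribution :: "real measure \<Rightarrow> bool" where
  "regular_distribution D \<longleftrightarrow> prob_space D \<and>
     (\<exists>f S. f \<in> borel_measurable borel \<and> D = density lborel (\<lambda>x. ennreal (f x)) \<and>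
        is_interval S \<and> S \<subseteq> {0..} \<and> (\<forall>x\<in>S. f x > 0) \<and> (\<forall>x. x \<notin> S \<longrightarrow> f x = 0) \<and>
        mono_on S (virtual_value D f))"


section \<open>Set systems and valuations\<close>

definition downward_closed_system :: "nat set \<Rightarrow> nat set set \<Rightarrow> bool" where
  "downward_closed_system M \<I> \<longleftrightarrow> \<I> \<subseteq> Pow M \<and> (\<forall>S\<in>\<I>. \<forall>T. T \<subseteq> S \<longrightarrow> T \<in> \<I>)"

text \<open>In both definitions \<open>x j\<close> is the bidder's value for the single item \<open>j\<close>.\<close>

definition additive_val :: "(nat \<Rightarrow> real) \<Rightarrow> nat set \<Rightarrow> real" where
  "additive_val x S = (\<Sum>j\<in>S. x j)"

definition additive_subject_to :: "nat set set \<Rightarrow> (nat \<Rightarrow> real) \<Rightarrow> nat set \<Rightarrow> real" where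
  "additive_subject_to \<I> x S = Max ((\<lambda>T. \<Sum>j\<in>T. x j) ` {T \<in> \<I>. T \<subseteq> S})"


section \<open>The VCG mechanism\<close>

text \<open>
  \<open>N\<close> is the set of bidders, \<open>M\<close> the set of items, and \<open>w i\<close> the valuation of bidder \<open>i\<close>.
  An allocation is extensional outside \<open>N\<close>, so that there are only finitely many and the maximum
  below is attained. Items may remain unallocated.
\<close>

definition allocations :: "nat set \<Rightarrow> nat set \<Rightarrow> (nat \<Rightarrow> nat set) set" where
  "allocations N M = {X \<in> N \<rightarrow>\<^sub>E Pow M. disjoint_family_on X N}"

definition welfare :: "(nat \<Rightarrow> nat set \<Rightarrow> real) \<Rightarrow> nat set \<Rightarrow> (nat \<Rightarrow> nat set) \<Rightarrow> real" where
  "welfare w N X = (\<Sum>i\<in>N. w i (X i))"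

definition max_welfare :: "(nat \<Rightarrow> nat set \<Rightarrow> real) \<Rightarrow> nat set \<Rightarrow> nat set \<Rightarrow> real" where
  "max_welfare w N M = Max (welfare w N ` allocations N M)"

text \<open>A VCG allocation rule picks a welfare-maximizing allocation, breaking ties arbitrarily.\<close>

definition vcg_rule ::
    "nat set \<Rightarrow> nat set \<Rightarrow> ((nat \<Rightarrow> nat set \<Rightarrow> real) \<Rightarrow> nat \<Rightarrow> nat set) \<Rightarrow> bool" where
  "vcg_rule N M A \<longleftrightarrow> (\<forall>w. is_arg_max (welfare w N) (\<lambda>X. X \<in> allocations N M) (A w))"

definition vcg_payment ::
    "(nat \<Rightarrow> nat set \<Rightarrow> real) \<Rightarrow> nat set \<Rightarrow> nat set \<Rightarrow> (nat \<Rightarrow> nat set) \<Rightarrow> nat \<Rightarrow> real" where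
  "vcg_payment w N M X i = max_welfare w (N - {i}) M - welfare w (N - {i}) X"

definition vcg_revenue ::
    "(nat \<Rightarrow> nat set \<Rightarrow> real) \<Rightarrow> nat set \<Rightarrow> nat set \<Rightarrow> (nat \<Rightarrow> nat set) \<Rightarrow> real" where
  "vcg_revenue w N M X = (\<Sum>i\<in>N. vcg_payment w N M X i)"

lemma finite_allocations: "finite N \<Longrightarrow> finite M \<Longrightarrow> finite (allocations N M)"
  unfolding allocations_def by (rule finite_subset[of _ "N \<rightarrow>\<^sub>E Pow M"]) (auto intro: finite_PiE)

lemma vcg_revenue_nonneg:
  assumes "finite N" "finite M" "X \<in> allocations N M"
  shows "vcg_revenue w N M X \<ge> 0"
  unfolding vcg_revenue_def vcg_payment_def
proof (intro sum_nonneg)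
  fix i assume "i \<in> N"
  let ?Y = "restrict X (N - {i})"
  have "?Y \<in> allocations (N - {i}) M"
    using assms(3) by (fastforce simp: allocations_def disjoint_family_on_def)
  hence "welfare w (N - {i}) ?Y \<le> max_welfare w (N - {i}) M"
    unfolding max_welfare_def using assms by (intro Max_ge) (auto intro: finite_allocations)
  moreover have "welfare w (N - {i}) ?Y = welfare w (N - {i}) X"
    unfolding welfare_def by (intro sum.cong) auto
  ultimately show "0 \<le> max_welfare w (N - {i}) M - welfare w (N - {i}) X" by simp
qed

text \<open>
  The expected revenue from \<open>n\<close> bidders whose vectors of item values are i.i.d. draws from the
  product of \<open>D 1, \<dots>, D m\<close>, where \<open>val\<close> turns a vector of item values into a valuation.
  It is taken in \<open>[0, \<infinity>]\<close>; by the previous lemma the coercion to \<open>ennreal\<close> loses nothing.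
\<close>

definition expected_vcg_revenue ::
    "((nat \<Rightarrow> nat set \<Rightarrow> real) \<Rightarrow> nat \<Rightarrow> nat set) \<Rightarrow> nat \<Rightarrow> nat \<Rightarrow> (nat \<Rightarrow> real measure)
      \<Rightarrow> ((nat \<Rightarrow> real) \<Rightarrow> nat set \<Rightarrow> real) \<Rightarrow> ennreal" where
  "expected_vcg_revenue A n m D val =
     (\<integral>\<^sup>+ v. (let w = (\<lambda>i. val (v i)) in ennreal (vcg_revenue w {1..n} {1..m} (A w)))
        \<partial>(PiM {1..n} (\<lambda>_. PiM {1..m} D)))"

end

theory Submission imports Defs begin

text \<open>
  The revenue is \<open>(\<Sum>i. W (N - i)) - (|N| - 1) W N\<close> for the maximum welfare \<open>W\<close>, whatever the
  tie-breaking. To bound \<open>W (N - i)\<close> from below under the constraint \<open>\<I>\<close>, take an optimal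
  assignment and hand the items of \<open>i\<close> one after the other to distinct losers. With \<open>n + m - 1\<close>
  bidders, at least \<open>n - 1\<close> losers compete for every item \<open>j\<close>, and given the winner of \<open>j\<close> they are
  determined by the values for the other items. So the revenue is at least the sum over \<open>j\<close> of the
  highest value of these competitors for \<open>j\<close>.

  Now fix the values for the other items. Item \<open>j\<close> goes to the bidder maximizing a score
  \<open>x i + c i\<close>, where \<open>c \<le> 0\<close>, and \<open>c = 0\<close> for at least \<open>n\<close> bidders. Given the winning
  score \<open>t\<close>, the competitors' values are independent and each dominates \<open>F\<close> conditioned on being at
  most \<open>t\<close>; and \<open>t\<close> dominates the maximum of \<open>n\<close> draws from \<open>F\<close>. Hence the highest competing
  value dominates the second highest of \<open>n\<close> draws, which is the additive bidders' payment for \<open>j\<close>.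
\<close>

section \<open>Stochastic dominance and product measures\<close>

lemma ennreal_sum_le: "ennreal (\<Sum>i\<in>A. f i) \<le> (\<Sum>i\<in>A. ennreal (f i))"
proof -
  have "ennreal (\<Sum>i\<in>A. f i) \<le> ennreal (\<Sum>i\<in>A. max 0 (f i))"
    by (intro ennreal_leI sum_mono) simp
  also have "\<dots> = (\<Sum>i\<in>A. ennreal (max 0 (f i)))"
    by (rule sum_ennreal[symmetric]) simp
  also have "\<dots> = (\<Sum>i\<in>A. ennreal (f i))"
    by (intro sum.cong) (auto simp: max_def ennreal_neg)
  finally show ?thesis .
qed

text \<open>Layer-cake formula: for fixed \<open>x\<close> the inner integral is the length of
  \<open>{0..<f x}\<close>, and the order of integration is exchanged. Negative values drop out on
  both sides, through \<open>ennreal\<close> and through the indicator of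
  \<open>{0..}\<close>.\<close>

lemma nn_integral_eq_tail_integral:
  fixes f :: "'a \<Rightarrow> real"
  assumes "sigma_finite_measure M" and [measurable]: "f \<in> borel_measurable M"
  shows "(\<integral>\<^sup>+x. ennreal (f x) \<partial>M) =
    (\<integral>\<^sup>+s. emeasure M {x\<in>space M. s < f x} * indicator {0..} s \<partial>lborel)"
proof -
  interpret M: sigma_finite_measure M by fact
  interpret pair_sigma_finite M lborel ..
  have "(\<integral>\<^sup>+x. ennreal (f x) \<partial>M) =
      (\<integral>\<^sup>+x. \<integral>\<^sup>+s. indicator {x\<in>space M. s < f x} x * indicator {0..} s \<partial>lborel \<partial>M)"
  proof (intro nn_integral_cong)
    fix x assume "x \<in> space M"
    then have "(\<integral>\<^sup>+s. indicator {x\<in>space M. s < f x} x * indicator {0..} s \<partial>lborel)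
        = (\<integral>\<^sup>+s. indicator {0..<f x} s \<partial>lborel)"
      by (intro nn_integral_cong) (auto simp: indicator_def)
    also have "\<dots> = ennreal (f x)"
      by (cases "0 \<le> f x") (auto simp: ennreal_neg)
    finally show "ennreal (f x) =
        (\<integral>\<^sup>+s. indicator {x\<in>space M. s < f x} x * indicator {0..} s \<partial>lborel)" ..
  qed
  also have "\<dots> = (\<integral>\<^sup>+s. \<integral>\<^sup>+x. indicator {x\<in>space M. s < f x} x * indicator {0..} s \<partial>M \<partial>lborel)"
    by (rule Fubini'[symmetric]) measurable
  also have "\<dots> = (\<integral>\<^sup>+s. emeasure M {x\<in>space M. s < f x} * indicator {0..} s \<partial>lborel)"
    by (intro nn_integral_cong, subst nn_integral_multc) simp_all
  finally show ?thesis .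
qed

text \<open>Complements turn the inequality between distribution functions into the reverse one
  between tails, which the layer-cake formula integrates.\<close>

lemma nn_integral_mono_stochastic_dominance:
  fixes f :: "'a \<Rightarrow> real" and g :: "'b \<Rightarrow> real"
  assumes "prob_space M" "prob_space N"
    and [measurable]: "f \<in> borel_measurable M" "g \<in> borel_measurable N"
    and dom: "\<And>s. emeasure M {x\<in>space M. f x \<le> s} \<le> emeasure N {y\<in>space N. g y \<le> s}"
  shows "(\<integral>\<^sup>+y. ennreal (g y) \<partial>N) \<le> (\<integral>\<^sup>+x. ennreal (f x) \<partial>M)"
proof -
  interpret M: prob_space M by fact
  interpret N: prob_space N by fact
  have *: "emeasure N {y\<in>space N. s < g y} \<le> emeasure M {x\<in>space M. s < f x}" for s
  proof -
    have "{y\<in>space N. s < g y} = space N - {y\<in>space N. g y \<le> s}"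
      "{x\<in>space M. s < f x} = space M - {x\<in>space M. f x \<le> s}" by auto
    then show ?thesis
      using dom[of s]
      by (simp add: M.emeasure_eq_measure N.emeasure_eq_measure M.prob_compl N.prob_compl)
  qed
  show ?thesis
    unfolding nn_integral_eq_tail_integral[OF M.sigma_finite_measure_axioms assms(3)]
      nn_integral_eq_tail_integral[OF N.sigma_finite_measure_axioms assms(4)]
    by (intro nn_integral_mono mult_right_mono *) auto
qed

lemma prod_indicator_family:
  assumes "finite K"
  shows "(\<Prod>l\<in>K. indicator (A l) (x l)) = (indicator {x. \<forall>l\<in>K. x l \<in> A l} x :: ennreal)"
  using assms by induction (auto simp: indicator_def)

text \<open>All entries of the profile are independent, so overwriting column \<open>j\<close> by
  fresh draws leaves its law unchanged. This is how the values for the other items are held fixed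
  while those for \<open>j\<close> vary.\<close>

lemma nn_integral_PiM_resample:
  fixes D :: "'j \<Rightarrow> 'a measure" and K :: "'i set"
  assumes D: "\<And>j. prob_space (D j)" and "finite K" "finite M" "j \<in> M"
    and f[measurable]: "f \<in> borel_measurable (PiM K (\<lambda>_. PiM M D))"
  shows "(\<integral>\<^sup>+v. f v \<partial>PiM K (\<lambda>_. PiM M D)) =
    (\<integral>\<^sup>+v. \<integral>\<^sup>+x. f (\<lambda>i\<in>K. (v i)(j := x i)) \<partial>PiM K (\<lambda>_. D j) \<partial>PiM K (\<lambda>_. PiM M D))"
proof -
  interpret D: product_prob_space D M by (intro product_prob_spaceI D)
  have P: "prob_space (PiM M D)" by (rule prob_space_PiM) (rule D)
  interpret P: product_prob_space "\<lambda>_::'i. PiM M D" K by (intro product_prob_spaceI P)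
  interpret Dj: product_prob_space "\<lambda>_::'i. D j" K by (intro product_prob_spaceI D)
  interpret KP: prob_space "PiM K (\<lambda>_. PiM M D)" by (rule prob_space_PiM) (rule P)
  have "prob_space (PiM K (\<lambda>_. D j))" by (rule prob_space_PiM) (rule D)
  then interpret KD: prob_space "PiM K (\<lambda>_. D j)" .
  have KD: "sigma_finite_measure (PiM K (\<lambda>_. D j))" ..
  interpret pair_prob_space "PiM K (\<lambda>_. PiM M D)" "PiM K (\<lambda>_. D j)" ..
  let ?T = "\<lambda>(v, x). \<lambda>i\<in>K. (v i)(j := x i)"
  have upd[measurable]: "(\<lambda>(y, z). y(j := z)) \<in> PiM M D \<Otimes>\<^sub>M D j \<rightarrow>\<^sub>M PiM M D"
    unfolding case_prod_beta by (rule measurable_fun_upd[where J = M]) (use \<open>j \<in> M\<close> in auto)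
  have T[measurable]: "?T \<in> PiM K (\<lambda>_. PiM M D) \<Otimes>\<^sub>M PiM K (\<lambda>_. D j) \<rightarrow>\<^sub>M PiM K (\<lambda>_. PiM M D)"
    unfolding case_prod_beta
  proof (rule measurable_restrict)
    fix i assume "i \<in> K"
    then have "(\<lambda>w. (fst w i, snd w i)) \<in> PiM K (\<lambda>_. PiM M D) \<Otimes>\<^sub>M PiM K (\<lambda>_. D j) \<rightarrow>\<^sub>M PiM M D \<Otimes>\<^sub>M D j"
      by measurable
    from measurable_compose[OF this upd]
    show "(\<lambda>w. (fst w i)(j := snd w i)) \<in> PiM K (\<lambda>_. PiM M D) \<Otimes>\<^sub>M PiM K (\<lambda>_. D j) \<rightarrow>\<^sub>M PiM M D"
      by simp
  qed
  \<comment> \<open>One row: the old entry at \<open>j\<close> is integrated out first, and the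
    integrand ignores it because it is overwritten.\<close>
  have single: "(\<integral>\<^sup>+y. \<integral>\<^sup>+z. indicator A (y(j := z)) \<partial>D j \<partial>PiM M D) = emeasure (PiM M D) A"
    if [measurable]: "A \<in> sets (PiM M D)" for A
  proof -
    have M: "M = insert j (M - {j})" using \<open>j \<in> M\<close> by auto
    have fin: "finite (M - {j})" "j \<notin> M - {j}" using \<open>finite M\<close> by auto
    have A': "A \<in> sets (PiM (insert j (M - {j})) D)" using that M by simp
    have m: "(\<lambda>y. \<integral>\<^sup>+z. indicator A (y(j := z)) \<partial>D j) \<in> borel_measurable (PiM (insert j (M - {j})) D)"
      using M by simp
    have "(\<integral>\<^sup>+y. \<integral>\<^sup>+z. indicator A (y(j := z)) \<partial>D j \<partial>PiM (insert j (M - {j})) D) =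
        (\<integral>\<^sup>+y. \<integral>\<^sup>+z'. \<integral>\<^sup>+z. indicator A (y(j := z)) \<partial>D j \<partial>D j \<partial>PiM (M - {j}) D)"
      by (subst D.product_nn_integral_insert[OF fin m]) simp
    also have "\<dots> = (\<integral>\<^sup>+y. \<integral>\<^sup>+z. indicator A (y(j := z)) \<partial>D j \<partial>PiM (M - {j}) D)"
      using D[of j] by (simp add: prob_space.emeasure_space_1)
    also have "\<dots> = (\<integral>\<^sup>+y. indicator A y \<partial>PiM (insert j (M - {j})) D)"
      by (rule D.product_nn_integral_insert[OF fin, symmetric]) (use A' in simp)
    finally show ?thesis using M that by simp
  qed
  \<comment> \<open>It suffices to compare the two laws on boxes, where the integral factors over
    the rows and \<open>single\<close> handles each of them.\<close>
  have "distr (PiM K (\<lambda>_. PiM M D) \<Otimes>\<^sub>M PiM K (\<lambda>_. D j)) (PiM K (\<lambda>_. PiM M D)) ?T = PiM K (\<lambda>_. PiM M D)"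
  proof (rule P.PiM_eqI)
    fix A assume A[measurable]: "\<And>i. i \<in> K \<Longrightarrow> A i \<in> sets (PiM M D)"
    let ?E = "Pi\<^sub>E K A"
    have E[measurable]: "?E \<in> sets (PiM K (\<lambda>_. PiM M D))"
      by (rule sets_PiM_I_finite) (use A \<open>finite K\<close> in auto)
    have "emeasure (distr (PiM K (\<lambda>_. PiM M D) \<Otimes>\<^sub>M PiM K (\<lambda>_. D j)) (PiM K (\<lambda>_. PiM M D)) ?T) ?E
      = (\<integral>\<^sup>+w. indicator ?E (?T w) \<partial>(PiM K (\<lambda>_. PiM M D) \<Otimes>\<^sub>M PiM K (\<lambda>_. D j)))"
      by (subst nn_integral_indicator[symmetric], simp, subst nn_integral_distr) auto
    also have "\<dots> = (\<integral>\<^sup>+v. \<integral>\<^sup>+x. indicator ?E (?T (v, x)) \<partial>PiM K (\<lambda>_. D j) \<partial>PiM K (\<lambda>_. PiM M D))"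
      by (rule sigma_finite_measure.nn_integral_fst[OF KD, symmetric]) measurable
    also have "\<dots> = (\<integral>\<^sup>+v. \<integral>\<^sup>+x. (\<Prod>i\<in>K. indicator (A i) ((v i)(j := x i))) \<partial>PiM K (\<lambda>_. D j) \<partial>PiM K (\<lambda>_. PiM M D))"
    proof (intro nn_integral_cong)
      fix v x
      show "indicator ?E (?T (v, x)) = (\<Prod>i\<in>K. indicator (A i) ((v i)(j := x i)) :: ennreal)"
        using prod_indicator_family[OF \<open>finite K\<close>, of A "\<lambda>i. (v i)(j := x i)"]
        by (auto simp: indicator_def PiE_iff)
    qed
    also have "\<dots> = (\<integral>\<^sup>+v. (\<Prod>i\<in>K. \<integral>\<^sup>+z. indicator (A i) ((v i)(j := z)) \<partial>D j) \<partial>PiM K (\<lambda>_. PiM M D))"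
    proof (intro nn_integral_cong Dj.product_nn_integral_prod \<open>finite K\<close>)
      fix v i assume v: "v \<in> space (PiM K (\<lambda>_. PiM M D))" and i: "i \<in> K"
      then have "v i \<in> space (PiM M D)" by (auto simp: space_PiM)
      then show "(\<lambda>z. indicator (A i) ((v i)(j := z))) \<in> borel_measurable (D j)"
        using A[OF i] upd by measurable
    qed
    also have "\<dots> = (\<Prod>i\<in>K. \<integral>\<^sup>+y. \<integral>\<^sup>+z. indicator (A i) (y(j := z)) \<partial>D j \<partial>PiM M D)"
      by (intro P.product_nn_integral_prod \<open>finite K\<close>) measurable
    also have "\<dots> = (\<Prod>i\<in>K. emeasure (PiM M D) (A i))"
      by (intro prod.cong refl single A)
    finally show "emeasure (distr (PiM K (\<lambda>_. PiM M D) \<Otimes>\<^sub>M PiM K (\<lambda>_. D j)) (PiM K (\<lambda>_. PiM M D)) ?T) ?E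
      = (\<Prod>i\<in>K. emeasure (PiM M D) (A i))" .
  qed (use \<open>finite K\<close> in auto)
  then have "(\<integral>\<^sup>+v. f v \<partial>PiM K (\<lambda>_. PiM M D)) =
     (\<integral>\<^sup>+v. f v \<partial>distr (PiM K (\<lambda>_. PiM M D) \<Otimes>\<^sub>M PiM K (\<lambda>_. D j)) (PiM K (\<lambda>_. PiM M D)) ?T)"
    by simp
  also have "\<dots> = (\<integral>\<^sup>+w. f (?T w) \<partial>(PiM K (\<lambda>_. PiM M D) \<Otimes>\<^sub>M PiM K (\<lambda>_. D j)))"
    by (rule nn_integral_distr) measurable
  also have "\<dots> = (\<integral>\<^sup>+v. \<integral>\<^sup>+x. f (?T (v, x)) \<partial>PiM K (\<lambda>_. D j) \<partial>PiM K (\<lambda>_. PiM M D))"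
    by (rule sigma_finite_measure.nn_integral_fst[OF KD, symmetric]) measurable
  finally show ?thesis by simp
qed

lemma AE_PiM_PiM:
  assumes "\<And>j. prob_space (D j)" "\<And>j. j \<in> M \<Longrightarrow> AE x in D j. Q x" "finite K" "finite M"
  shows "AE v in PiM K (\<lambda>_. PiM M D). \<forall>i\<in>K. \<forall>j\<in>M. Q (v i j)"
proof (intro AE_finite_allI assms(3,4))
  fix i j assume "i \<in> K" "j \<in> M"
  have "AE y in PiM M D. Q (y j)" by (rule AE_PiM_component[where M = D and P = Q, OF assms(1) \<open>j \<in> M\<close> assms(2)[OF \<open>j \<in> M\<close>]])
  then show "AE v in PiM K (\<lambda>_. PiM M D). Q (v i j)"
    by (rule AE_PiM_component[where P = "\<lambda>y. Q (y j)", OF prob_space_PiM[OF assms(1)] \<open>i \<in> K\<close>])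
qed

lemma measurable_replace_column:
  assumes "v \<in> space (PiM K (\<lambda>_. PiM M D))" "j \<in> M"
  shows "(\<lambda>x. \<lambda>i\<in>K. (v i)(j := x i)) \<in> PiM K (\<lambda>_. D j) \<rightarrow>\<^sub>M PiM K (\<lambda>_. PiM M D)"
proof (rule measurable_restrict)
  fix i assume i: "i \<in> K"
  then have "v i \<in> space (PiM M D)" using assms(1) by (auto simp: space_PiM)
  then show "(\<lambda>x. (v i)(j := x i)) \<in> PiM K (\<lambda>_. D j) \<rightarrow>\<^sub>M PiM M D"
    by (intro measurable_fun_upd[where J = M]) (use assms(2) i in auto)
qed

section \<open>The price of a single item\<close>

text \<open>Removing \<open>i\<close> leaves the maximum unchanged unless \<open>i\<close> is the
  only maximizer, so the minimum over \<open>i\<close> is the second highest value, with ties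
  counted. It is meaningful for at least two elements.\<close>

definition second_max :: "'i set \<Rightarrow> ('i \<Rightarrow> real) \<Rightarrow> real" where
  "second_max K x = Min ((\<lambda>i. Max (x ` (K - {i}))) ` K)"

lemma second_max_le:
  assumes "finite K" "2 \<le> card K" "i \<in> K" "\<And>l. l \<in> K - {i} \<Longrightarrow> x l \<le> s"
  shows "second_max K x \<le> s"
proof -
  have "card (K - {i}) \<noteq> 0" using assms(1-3) by simp
  then have "K - {i} \<noteq> {}" by (metis card.empty)
  then have "Max (x ` (K - {i})) \<le> s" using assms by (subst Max_le_iff) auto
  moreover have "second_max K x \<le> Max (x ` (K - {i}))"
    unfolding second_max_def using assms by (intro Min_le) auto
  ultimately show ?thesis by simp
qed

lemma second_max_cong: "(\<And>i. i \<in> K \<Longrightarrow> x i = y i) \<Longrightarrow> second_max K x = second_max K y"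
  unfolding second_max_def by (intro arg_cong[of _ _ Min] image_cong arg_cong[of _ _ Max]) auto

lemma borel_measurable_second_max[measurable]:
  assumes "finite K" "\<And>i. i \<in> K \<Longrightarrow> (\<lambda>w. f w i) \<in> borel_measurable M"
  shows "(\<lambda>w. second_max K (f w)) \<in> borel_measurable M"
  unfolding second_max_def using assms
  by (intro borel_measurable_Min borel_measurable_Max) auto

context real_distribution
begin

section \<open>Conditioning on one coordinate\<close>

text \<open>Given \<open>x i = y\<close>, the other coordinates are independent and each constraint
  involves only one of them, so the conditional probability is a product.\<close>

lemma nn_integral_PiM_given_coordinate:
  fixes K :: "'i set"
  assumes "finite K" "i \<in> K" and [measurable]: "g \<in> borel_measurable borel"
    and P[measurable]: "\<And>l. l \<in> K - {i} \<Longrightarrow> Measurable.pred (borel \<Otimes>\<^sub>M borel) (\<lambda>w. P l (fst w) (snd w))"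
  shows "(\<integral>\<^sup>+x. g (x i) * indicator {x. \<forall>l\<in>K-{i}. P l (x i) (x l)} x \<partial>PiM K (\<lambda>_. M)) =
    (\<integral>\<^sup>+y. g y * (\<Prod>l\<in>K-{i}. emeasure M {z. P l y z}) \<partial>M)"
proof -
  interpret M: product_prob_space "\<lambda>_::'i. M" K ..
  have K: "K = insert i (K - {i})" "finite (K - {i})" "i \<notin> K - {i}" using assms(1,2) by auto
  let ?G = "\<lambda>x. g (x i) * (\<Prod>l\<in>K-{i}. indicator {w. P l (fst w) (snd w)} (x i, x l))"
  have m: "{w. P l (fst w) (snd w)} \<in> sets (borel \<Otimes>\<^sub>M borel)" if "l \<in> K - {i}" for l
    using P[OF that] by (simp add: pred_def space_pair_measure)
  have [measurable]: "?G \<in> borel_measurable (PiM K (\<lambda>_. M))"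
  proof (intro borel_measurable_times_ennreal borel_measurable_prod_ennreal)
    show "(\<lambda>x. g (x i)) \<in> borel_measurable (Pi\<^sub>M K (\<lambda>_. M))"
      using assms(2) by measurable
    fix l assume "l \<in> K - {i}"
    then have [measurable]: "l \<in> K" "i \<in> K" using assms(2) by auto
    have "(\<lambda>x. (x i, x l)) \<in> Pi\<^sub>M K (\<lambda>_. M) \<rightarrow>\<^sub>M borel \<Otimes>\<^sub>M borel"
      by measurable
    from measurable_compose[OF this borel_measurable_indicator[OF m[OF \<open>l \<in> K - {i}\<close>]]]
    show "(\<lambda>x. indicator {w. P l (fst w) (snd w)} (x i, x l) :: ennreal) \<in> borel_measurable (Pi\<^sub>M K (\<lambda>_. M))" .
  qed
  have "(\<integral>\<^sup>+x. g (x i) * indicator {x. \<forall>l\<in>K-{i}. P l (x i) (x l)} x \<partial>PiM K (\<lambda>_. M)) =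
      (\<integral>\<^sup>+x. ?G x \<partial>PiM (insert i (K - {i})) (\<lambda>_. M))"
    unfolding K(1)[symmetric]
  proof (intro nn_integral_cong arg_cong2[of _ _ _ _ "(*)"] refl)
    fix x
    show "indicator {x. \<forall>l\<in>K-{i}. P l (x i) (x l)} x =
        (\<Prod>l\<in>K-{i}. indicator {w. P l (fst w) (snd w)} (x i, x l) :: ennreal)"
      using prod_indicator_family[OF K(2), of "\<lambda>l. {w. P l (fst w) (snd w)}" "\<lambda>l. (x i, x l)"]
      by (auto simp: indicator_def)
  qed
  also have "\<dots> = (\<integral>\<^sup>+y. \<integral>\<^sup>+x. ?G (x(i := y)) \<partial>PiM (K - {i}) (\<lambda>_. M) \<partial>M)"
    by (rule M.product_nn_integral_insert_rev[OF K(2,3)]) (simp flip: K(1))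
  also have "\<dots> = (\<integral>\<^sup>+y. \<integral>\<^sup>+x. g y * (\<Prod>l\<in>K-{i}. indicator {z. P l y z} (x l)) \<partial>PiM (K - {i}) (\<lambda>_. M) \<partial>M)"
    by (intro nn_integral_cong arg_cong2[of _ _ _ _ "(*)"] prod.cong) (auto simp: indicator_def)
  also have "\<dots> = (\<integral>\<^sup>+y. g y * (\<Prod>l\<in>K-{i}. emeasure M {z. P l y z}) \<partial>M)"
  proof (intro nn_integral_cong)
    fix y
    have sect: "{z. P l y z} \<in> sets M" if "l \<in> K - {i}" for l
    proof -
      have "(\<lambda>z. (y, z)) -` {w. P l (fst w) (snd w)} \<inter> space M \<in> sets M"
        by (rule measurable_sets[OF _ m[OF that]]) measurable
      then show ?thesis by simp
    qed
    have ind: "(\<lambda>z. indicator {z. P l y z} z :: ennreal) \<in> borel_measurable M" if "l \<in> K - {i}" for l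
      using sect[OF that] by (rule borel_measurable_indicator)
    have "(\<integral>\<^sup>+x. g y * (\<Prod>l\<in>K-{i}. indicator {z. P l y z} (x l)) \<partial>PiM (K - {i}) (\<lambda>_. M)) =
        g y * (\<integral>\<^sup>+x. (\<Prod>l\<in>K-{i}. indicator {z. P l y z} (x l)) \<partial>PiM (K - {i}) (\<lambda>_. M))"
    proof (rule nn_integral_cmult, rule borel_measurable_prod_ennreal)
      fix l assume l: "l \<in> K - {i}"
      show "(\<lambda>x. indicator {z. P l y z} (x l) :: ennreal) \<in> borel_measurable (PiM (K - {i}) (\<lambda>_. M))"
        using measurable_compose[OF measurable_component_singleton[OF l] ind[OF l]] .
    qed
    also have "(\<integral>\<^sup>+x. (\<Prod>l\<in>K-{i}. indicator {z. P l y z} (x l)) \<partial>PiM (K - {i}) (\<lambda>_. M)) =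
        (\<Prod>l\<in>K-{i}. \<integral>\<^sup>+z. indicator {z. P l y z} z \<partial>M)"
      by (rule M.product_nn_integral_prod[OF K(2)]) (rule ind)
    also have "\<dots> = (\<Prod>l\<in>K-{i}. emeasure M {z. P l y z})"
      by (intro prod.cong refl nn_integral_indicator sect)
    finally show "(\<integral>\<^sup>+x. g y * (\<Prod>l\<in>K-{i}. indicator {z. P l y z} (x l)) \<partial>PiM (K - {i}) (\<lambda>_. M)) =
        g y * (\<Prod>l\<in>K-{i}. emeasure M {z. P l y z})" .
  qed
  finally show ?thesis .
qed

lemma borel_measurable_PiM_given_coordinate:
  fixes K :: "'i set"
  assumes "finite K" "i \<in> K" and g: "g \<in> borel_measurable borel"
    and P: "\<And>l. l \<in> K - {i} \<Longrightarrow> Measurable.pred (borel \<Otimes>\<^sub>M borel) (\<lambda>w. P l (fst w) (snd w))"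
  shows "(\<lambda>x. g (x i) * indicator {x. \<forall>l\<in>K-{i}. P l (x i) (x l)} x :: ennreal)
    \<in> borel_measurable (PiM K (\<lambda>_. M))"
proof (intro borel_measurable_times_ennreal)
  show "(\<lambda>x. g (x i)) \<in> borel_measurable (PiM K (\<lambda>_. M))"
    using assms(2) g by measurable
  have "Measurable.pred (PiM K (\<lambda>_. M)) (\<lambda>x. \<forall>l\<in>K-{i}. P l (x i) (x l))"
  proof (intro pred_intros_finite)
    fix l assume l: "l \<in> K - {i}"
    then have [measurable]: "l \<in> K" "i \<in> K" using assms(2) by auto
    have "(\<lambda>x. (x i, x l)) \<in> PiM K (\<lambda>_. M) \<rightarrow>\<^sub>M borel \<Otimes>\<^sub>M borel"
      by measurable
    from measurable_compose[OF this P[OF l]]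
    show "Measurable.pred (PiM K (\<lambda>_. M)) (\<lambda>x. P l (x i) (x l))" by simp
  qed (use assms(1) in auto)
  then show "indicator {x. \<forall>l\<in>K-{i}. P l (x i) (x l)} \<in> borel_measurable (PiM K (\<lambda>_. M))"
    by (intro borel_measurable_indicator') simp
qed

lemma nn_integral_PiM_sum_given_coordinate:
  fixes K :: "'i set"
  assumes "finite K" "I \<subseteq> K" and g: "\<And>i. i \<in> I \<Longrightarrow> g i \<in> borel_measurable borel"
    and P: "\<And>i l. i \<in> I \<Longrightarrow> l \<in> K - {i} \<Longrightarrow>
      Measurable.pred (borel \<Otimes>\<^sub>M borel) (\<lambda>w. P i l (fst w) (snd w))"
  shows "(\<integral>\<^sup>+x. (\<Sum>i\<in>I. g i (x i) * indicator {x. \<forall>l\<in>K-{i}. P i l (x i) (x l)} x) \<partial>PiM K (\<lambda>_. M)) =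
    (\<Sum>i\<in>I. \<integral>\<^sup>+y. g i y * (\<Prod>l\<in>K-{i}. emeasure M {z. P i l y z}) \<partial>M)"
proof -
  have "(\<integral>\<^sup>+x. (\<Sum>i\<in>I. g i (x i) * indicator {x. \<forall>l\<in>K-{i}. P i l (x i) (x l)} x) \<partial>PiM K (\<lambda>_. M)) =
    (\<Sum>i\<in>I. \<integral>\<^sup>+x. g i (x i) * indicator {x. \<forall>l\<in>K-{i}. P i l (x i) (x l)} x \<partial>PiM K (\<lambda>_. M))"
    by (intro nn_integral_sum borel_measurable_PiM_given_coordinate g P) (use assms(1,2) in auto)
  also have "\<dots> = (\<Sum>i\<in>I. \<integral>\<^sup>+y. g i y * (\<Prod>l\<in>K-{i}. emeasure M {z. P i l y z}) \<partial>M)"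
    by (intro sum.cong refl nn_integral_PiM_given_coordinate g P) (use assms(1,2) in auto)
  finally show ?thesis .
qed

text \<open>Once \<open>x i\<close> is known, a tie forces another coordinate to a single point,
  which has mass zero. The shifts \<open>c\<close> cover both plain values (\<open>c = 0\<close>)
  and scores.\<close>

lemma AE_PiM_no_ties:
  fixes K :: "'i set"
  assumes "finite K" and atomless: "\<And>a. emeasure M {a} = 0"
  shows "AE x in PiM K (\<lambda>_. M). \<forall>i\<in>K. \<forall>l\<in>K-{i}. x l + c l \<noteq> x i + c i"
proof (intro AE_finite_allI)
  fix i l assume i: "i \<in> K" and l: "l \<in> K - {i}"
  let ?P = "\<lambda>l' y z. l' = l \<longrightarrow> z = y + (c i - c l)"
  let ?f = "\<lambda>x. (1::ennreal) * indicator {x. \<forall>l'\<in>K-{i}. ?P l' (x i) (x l')} x"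
  have P: "Measurable.pred (borel \<Otimes>\<^sub>M borel) (\<lambda>w. ?P l' (fst w) (snd w))" for l'
    by measurable
  have z: "emeasure M {z. z = y + (c i - c l)} = 0" for y
    using atomless[of "y + (c i - c l)"] by simp
  have "(\<Prod>l'\<in>K-{i}. emeasure M {z. ?P l' y z}) = 0" for y
    using l \<open>finite K\<close> z[of y] by (intro prod_zero bexI[of _ l]) auto
  then have "(\<integral>\<^sup>+y. (1::ennreal) * (\<Prod>l'\<in>K-{i}. emeasure M {z. ?P l' y z}) \<partial>M) = 0"
    by (simp only: mult_zero_right nn_integral_const mult_zero_left)
  with nn_integral_PiM_given_coordinate[OF assms(1) i, of "\<lambda>_. 1" ?P] P
  have "(\<integral>\<^sup>+x. ?f x \<partial>PiM K (\<lambda>_. M)) = 0" by (simp only: borel_measurable_const)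
  then have "AE x in PiM K (\<lambda>_. M). ?f x = 0"
    by (subst (asm) nn_integral_0_iff_AE)
      (use borel_measurable_PiM_given_coordinate[OF assms(1) i, of "\<lambda>_. 1" ?P] P in auto)
  then show "AE x in PiM K (\<lambda>_. M). x l + c l \<noteq> x i + c i"
  proof eventually_elim
    case (elim x)
    then have "x \<notin> {x. \<forall>l'\<in>K-{i}. ?P l' (x i) (x l')}"
      by (auto simp: indicator_def split: if_splits)
    then show ?case by auto
  qed
qed (use assms(1) in auto)

section \<open>Distribution of the second highest value and of the losers' values\<close>

text \<open>The event is split according to the highest bidder \<open>i\<close>, with value
  \<open>y\<close>: the \<open>card K - 1\<close> others must lie below both \<open>y\<close> and
  \<open>s\<close>. Without ties these cases are disjoint, so their probabilities may be
  added.\<close>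

lemma emeasure_second_max_ge:
  fixes K :: "'i set"
  assumes K: "finite K" "2 \<le> card K" and atomless: "\<And>a. emeasure M {a} = 0"
  shows "of_nat (card K) * (\<integral>\<^sup>+y. emeasure M {..min s y} ^ (card K - 1) \<partial>M) \<le>
    emeasure (PiM K (\<lambda>_. M)) {x\<in>space (PiM K (\<lambda>_. M)). second_max K x \<le> s}"
proof -
  let ?P = "\<lambda>i l y z::real. z \<le> min s y"
  let ?I = "\<lambda>i. indicator {x. \<forall>l\<in>K-{i}. ?P i l (x i) (x l)} :: _ \<Rightarrow> ennreal"
  have P: "Measurable.pred (borel \<Otimes>\<^sub>M borel) (\<lambda>w. ?P i l (fst w) (snd w))" for i l :: 'i
    by measurable
  have "of_nat (card K) * (\<integral>\<^sup>+y. emeasure M {..min s y} ^ (card K - 1) \<partial>M) =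
      (\<Sum>i\<in>K. \<integral>\<^sup>+y. 1 * (\<Prod>l\<in>K-{i}. emeasure M {z. ?P i l y z}) \<partial>M)"
    using K(1) by (simp add: atMost_def)
  also have "\<dots> = (\<integral>\<^sup>+x. (\<Sum>i\<in>K. 1 * ?I i x) \<partial>PiM K (\<lambda>_. M))"
    by (rule nn_integral_PiM_sum_given_coordinate[symmetric]) (use K P in auto)
  also have "\<dots> \<le> (\<integral>\<^sup>+x. indicator {x\<in>space (PiM K (\<lambda>_. M)). second_max K x \<le> s} x \<partial>PiM K (\<lambda>_. M))"
  proof (rule nn_integral_mono_AE)
    show "AE x in PiM K (\<lambda>_. M). (\<Sum>i\<in>K. 1 * ?I i x) \<le>
        indicator {x\<in>space (PiM K (\<lambda>_. M)). second_max K x \<le> s} x"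
      using AE_PiM_no_ties[OF K(1) atomless, of "\<lambda>_. 0"] AE_space
    proof eventually_elim
      case (elim x)
      show ?case
      proof (cases "\<exists>i\<in>K. \<forall>l\<in>K-{i}. x l \<le> min s (x i)")
        case True
        then obtain i where i: "i \<in> K" "\<forall>l\<in>K-{i}. x l \<le> min s (x i)" by blast
        have "(\<Sum>l\<in>K-{i}. ?I l x) = 0"
        proof (intro sum.neutral ballI)
          fix l assume l: "l \<in> K - {i}"
          then have "x l < x i" using elim(1) i by (metis min.bounded_iff order_less_le)
          then have "\<not> (\<forall>l'\<in>K-{l}. x l' \<le> min s (x l))" using i(1) l by force
          then show "?I l x = 0" by simp
        qed
        moreover have "?I i x = 1" using i by (auto simp: indicator_def)
        ultimately have "(\<Sum>i\<in>K. 1 * ?I i x) = 1"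
          using i(1) K(1) by (simp add: sum.remove[of K i])
        moreover have "second_max K x \<le> s"
          by (rule second_max_le[OF K i(1)]) (use i(2) in auto)
        ultimately show ?thesis using elim(2) by simp
      next
        case False
        then have "(\<Sum>i\<in>K. 1 * ?I i x) = 0"
          by (intro sum.neutral) (auto simp: indicator_def)
        then show ?thesis by simp
      qed
    qed
  qed
  also have "\<dots> = emeasure (PiM K (\<lambda>_. M)) {x\<in>space (PiM K (\<lambda>_. M)). second_max K x \<le> s}"
  proof (rule nn_integral_indicator)
    have "(\<lambda>x. second_max K x) \<in> borel_measurable (PiM K (\<lambda>_. M))"
      using K(1) by (intro borel_measurable_second_max) auto
    then show "{x\<in>space (PiM K (\<lambda>_. M)). second_max K x \<le> s} \<in> sets (PiM K (\<lambda>_. M))"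
      by measurable
  qed
  finally show ?thesis .
qed

text \<open>
  Conditionally on bidder \<open>i\<close> having the largest score \<open>x i + c i = t\<close>, the other
  coordinates are independent, and each is distributed as \<open>M\<close> conditioned on being at most
  \<open>t - c l \<ge> t\<close>. Hence each of them is at most \<open>s\<close> with probability at most
  \<open>cond_cdf s t\<close>. This bound decreases in \<open>t\<close>, and \<open>t\<close> is at least the maximum over \<open>U\<close>.
\<close>

definition cond_cdf :: "real \<Rightarrow> real \<Rightarrow> real" where
  "cond_cdf s t = (if t \<le> s then 1 else cdf M s / cdf M t)"

lemma cond_cdf_nonneg: "0 \<le> cond_cdf s t"
  by (simp add: cond_cdf_def cdf_nonneg)

lemma cond_cdf_antimono:
  assumes "t \<le> t'" shows "cond_cdf s t' \<le> cond_cdf s t"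
proof (cases "t \<le> s")
  case True
  then show ?thesis
    using cdf_nondecreasing[of s t'] cdf_nonneg[of t'] cdf_nonneg[of s]
    by (auto simp: cond_cdf_def divide_le_eq_1)
next
  case False
  then have "cdf M s \<le> cdf M t" "cdf M t \<le> cdf M t'" using assms by (auto intro: cdf_nondecreasing)
  \<comment> \<open>If \<open>cdf M t = 0\<close>, then \<open>cdf M s = 0\<close> as well, and both
    quotients are \<open>0\<close>.\<close>
  then show ?thesis
    using False assms cdf_nonneg[of s] cdf_nonneg[of t]
    by (cases "cdf M t = 0") (auto simp: cond_cdf_def intro!: divide_left_mono)
qed

text \<open>\<open>t\<close> is the winning score and \<open>t'\<close> the larger threshold that a
  loser may not exceed. The sharp factor would be \<open>cond_cdf s t'\<close>, which is at most
  \<open>cond_cdf s t\<close>.\<close>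

lemma emeasure_le_cond_cdf:
  assumes "t \<le> t'"
  shows "emeasure M {z. z \<le> t' \<and> z \<le> s} \<le> ennreal (cond_cdf s t) * emeasure M {z. z \<le> t'}"
proof -
  have "{z. z \<le> t' \<and> z \<le> s} = {..min t' s}" "{z. z \<le> t'} = {..t'}" by auto
  moreover have "cdf M (min t' s) \<le> cond_cdf s t * cdf M t'"
  proof (cases "t \<le> s")
    case True
    then show ?thesis by (simp add: cond_cdf_def cdf_nondecreasing)
  next
    case False
    then have "cdf M s \<le> cdf M t" "cdf M t \<le> cdf M t'" using assms by (auto intro: cdf_nondecreasing)
    moreover have "min t' s = s" using False assms by auto
    moreover have "cdf M s / cdf M t * cdf M t \<le> cdf M s / cdf M t * cdf M t'"
      using calculation cdf_nonneg by (intro mult_left_mono) auto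
    ultimately show ?thesis
      using False cdf_nonneg[of s] by (cases "cdf M t = 0") (auto simp: cond_cdf_def)
  qed
  ultimately show ?thesis
    by (simp add: emeasure_eq_measure cdf_def2 cond_cdf_nonneg flip: ennreal_mult)
qed

lemma cond_cdf_mult_le:
  "ennreal (cond_cdf s y) * emeasure M {z. z \<le> y} \<le> emeasure M {..min s y}"
proof -
  have "cond_cdf s y * cdf M y \<le> cdf M (min s y)"
    using cdf_nonneg[of s] by (cases "y \<le> s") (auto simp: cond_cdf_def min_def)
  then show ?thesis
    by (simp add: emeasure_eq_measure cdf_def2 cond_cdf_nonneg atMost_def flip: ennreal_mult)
qed

lemma borel_measurable_cond_cdf[measurable]: "cond_cdf s \<in> borel_measurable borel"
proof -
  have "(\<lambda>t. - cond_cdf s t) \<in> borel_measurable borel"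
    by (intro borel_measurable_mono monoI) (simp add: cond_cdf_antimono)
  from borel_measurable_uminus[OF this] show ?thesis by simp
qed

text \<open>The right-hand side is the lower bound obtained for \<open>second_max\<close> of
  \<open>card U\<close> draws. \<open>U\<close> collects bidders without a penalty, and
  \<open>R i\<close> the competitors that remain when \<open>i\<close> wins.\<close>

lemma emeasure_losers_le:
  fixes K U :: "'i set" and c :: "'i \<Rightarrow> real"
  assumes K: "finite K" and U: "U \<subseteq> K" "U \<noteq> {}" and atomless: "\<And>a. emeasure M {a} = 0"
    and c: "\<And>i. i \<in> K \<Longrightarrow> c i \<le> 0" "\<And>i. i \<in> U \<Longrightarrow> c i = 0"
    and R: "\<And>i. i \<in> K \<Longrightarrow> R i \<subseteq> K - {i}" "\<And>i. i \<in> K \<Longrightarrow> card (R i) = card U - 1"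
    and Q: "Q \<in> sets (PiM K (\<lambda>_. M))"
    and winner: "AE x in PiM K (\<lambda>_. M). x \<in> Q \<longrightarrow>
      (\<exists>i\<in>K. (\<forall>l\<in>K. x l + c l \<le> x i + c i) \<and> (\<forall>l\<in>R i. x l \<le> s))"
  shows "emeasure (PiM K (\<lambda>_. M)) Q \<le>
    of_nat (card U) * (\<integral>\<^sup>+y. emeasure M {..min s y} ^ (card U - 1) \<partial>M)"
proof -
  let ?k = "card U - 1" and ?r = "\<lambda>t. ennreal (cond_cdf s t)"
  \<comment> \<open>\<open>?A\<close>: \<open>i\<close> wins at value \<open>y\<close> and the
    competitors are at most \<open>s\<close>; \<open>?B\<close>: \<open>i\<close> wins;
    \<open>?C\<close>: \<open>i\<close> is highest within \<open>U\<close>, bidders outside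
    \<open>U\<close> being free.\<close>
  let ?A = "\<lambda>i l y z. z \<le> y + (c i - c l) \<and> (l \<in> R i \<longrightarrow> z \<le> s)"
  let ?B = "\<lambda>i l y z. z \<le> y + (c i - c l)"
  let ?C = "\<lambda>i l y z::real. l \<in> U \<longrightarrow> z \<le> y"
  have A: "Measurable.pred (borel \<Otimes>\<^sub>M borel) (\<lambda>w. ?A i l (fst w) (snd w))"
    and B: "Measurable.pred (borel \<Otimes>\<^sub>M borel) (\<lambda>w. ?B i l (fst w) (snd w))"
    and C: "Measurable.pred (borel \<Otimes>\<^sub>M borel) (\<lambda>w. ?C i l (fst w) (snd w))" for i l
    by measurable
  have "emeasure (PiM K (\<lambda>_. M)) Q = (\<integral>\<^sup>+x. indicator Q x \<partial>PiM K (\<lambda>_. M))"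
    using Q by simp
  also have "\<dots> \<le> (\<integral>\<^sup>+x. (\<Sum>i\<in>K. 1 * indicator {x. \<forall>l\<in>K-{i}. ?A i l (x i) (x l)} x) \<partial>PiM K (\<lambda>_. M))"
  proof (rule nn_integral_mono_AE)
    show "AE x in PiM K (\<lambda>_. M). indicator Q x \<le>
        (\<Sum>i\<in>K. 1 * indicator {x. \<forall>l\<in>K-{i}. ?A i l (x i) (x l)} x :: ennreal)"
      using winner
    proof eventually_elim
      case (elim x)
      show ?case
      proof (cases "x \<in> Q")
        case True
        then obtain i where i: "i \<in> K" "\<forall>l\<in>K. x l + c l \<le> x i + c i" "\<forall>l\<in>R i. x l \<le> s"
          using elim by blast
        have "x l \<le> x i + (c i - c l)" if "l \<in> K" for l using i(2) that by force
        then have "1 = (1 * indicator {x. \<forall>l\<in>K-{i}. ?A i l (x i) (x l)} x :: ennreal)"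
          using i by (simp add: indicator_def)
        also have "\<dots> \<le> (\<Sum>i\<in>K. 1 * indicator {x. \<forall>l\<in>K-{i}. ?A i l (x i) (x l)} x)"
          by (rule member_le_sum) (use i(1) K in auto)
        finally show ?thesis using True by simp
      qed simp
    qed
  qed
  also have "\<dots> = (\<Sum>i\<in>K. \<integral>\<^sup>+y. 1 * (\<Prod>l\<in>K-{i}. emeasure M {z. ?A i l y z}) \<partial>M)"
    by (rule nn_integral_PiM_sum_given_coordinate) (use K A in auto)
  \<comment> \<open>The winning score is \<open>y + c i\<close>. As \<open>c l \<le> 0\<close>, the
    threshold for \<open>l\<close> is at least this score, so each of the \<open>?k\<close>
    competitors contributes a factor \<open>?r (y + c i)\<close>.\<close>
  also have "\<dots> \<le> (\<Sum>i\<in>K. \<integral>\<^sup>+y. ?r (y + c i) ^ ?k * (\<Prod>l\<in>K-{i}. emeasure M {z. ?B i l y z}) \<partial>M)"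
  proof (intro sum_mono nn_integral_mono)
    fix i y assume i: "i \<in> K"
    have "(\<Prod>l\<in>K-{i}. emeasure M {z. ?A i l y z}) \<le>
        (\<Prod>l\<in>K-{i}. (if l \<in> R i then ?r (y + c i) else 1) * emeasure M {z. ?B i l y z})"
    proof (rule prod_mono_ennreal)
      fix l assume "l \<in> K - {i}"
      then have "y + c i \<le> y + (c i - c l)" using c(1)[of l] by simp
      from emeasure_le_cond_cdf[OF this, of s]
      show "emeasure M {z. ?A i l y z} \<le> (if l \<in> R i then ?r (y + c i) else 1) * emeasure M {z. ?B i l y z}"
        by simp
    qed
    also have "\<dots> = (\<Prod>l\<in>K-{i}. if l \<in> R i then ?r (y + c i) else 1) *
        (\<Prod>l\<in>K-{i}. emeasure M {z. ?B i l y z})"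
      by (rule prod.distrib)
    also have "(\<Prod>l\<in>K-{i}. if l \<in> R i then ?r (y + c i) else 1) = ?r (y + c i) ^ ?k"
    proof -
      have "(K - {i}) \<inter> {l. l \<in> R i} = R i" using R(1)[OF i] by auto
      then show ?thesis using R(2)[OF i] K by (simp add: prod.If_cases)
    qed
    finally show "1 * (\<Prod>l\<in>K-{i}. emeasure M {z. ?A i l y z}) \<le>
        ?r (y + c i) ^ ?k * (\<Prod>l\<in>K-{i}. emeasure M {z. ?B i l y z})" by simp
  qed
  also have "\<dots> = (\<integral>\<^sup>+x. (\<Sum>i\<in>K. ?r (x i + c i) ^ ?k *
      indicator {x. \<forall>l\<in>K-{i}. ?B i l (x i) (x l)} x) \<partial>PiM K (\<lambda>_. M))"
    by (rule nn_integral_PiM_sum_given_coordinate[symmetric]) (use K B in auto)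
  \<comment> \<open>Without ties at most one summand on the left is nonzero. Its score is at least
    the value of the best \<open>u\<close> in \<open>U\<close>, where \<open>c\<close> vanishes, and
    \<open>cond_cdf\<close> is antitone.\<close>
  also have "\<dots> \<le> (\<integral>\<^sup>+x. (\<Sum>u\<in>U. ?r (x u) ^ ?k *
      indicator {x. \<forall>l\<in>K-{u}. ?C u l (x u) (x l)} x) \<partial>PiM K (\<lambda>_. M))"
  proof (rule nn_integral_mono_AE)
    show "AE x in PiM K (\<lambda>_. M).
      (\<Sum>i\<in>K. ?r (x i + c i) ^ ?k * indicator {x. \<forall>l\<in>K-{i}. ?B i l (x i) (x l)} x) \<le>
      (\<Sum>u\<in>U. ?r (x u) ^ ?k * indicator {x. \<forall>l\<in>K-{u}. ?C u l (x u) (x l)} x)"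
      using AE_PiM_no_ties[OF K atomless, of c]
    proof eventually_elim
      case (elim x)
      show ?case
      proof (cases "\<exists>i\<in>K. \<forall>l\<in>K-{i}. x l \<le> x i + (c i - c l)")
        case True
        then obtain i where i: "i \<in> K" "\<forall>l\<in>K-{i}. x l \<le> x i + (c i - c l)" by blast
        have "\<not> (\<forall>l'\<in>K-{l}. x l' \<le> x l + (c l - c l'))" if "l \<in> K - {i}" for l
        proof
          assume "\<forall>l'\<in>K-{l}. x l' \<le> x l + (c l - c l')"
          then have "x i \<le> x l + (c l - c i)" using that i(1) by blast
          moreover have "x l \<le> x i + (c i - c l)" "x l + c l \<noteq> x i + c i"
            using elim i that by blast+
          ultimately show False by simp
        qed
        then have "(\<Sum>l\<in>K-{i}. ?r (x l + c l) ^ ?k * indicator {x. \<forall>l'\<in>K-{l}. ?B l l' (x l) (x l')} x) = 0"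
          by (intro sum.neutral) (simp add: indicator_def)
        then have "(\<Sum>i\<in>K. ?r (x i + c i) ^ ?k * indicator {x. \<forall>l\<in>K-{i}. ?B i l (x i) (x l)} x) =
            ?r (x i + c i) ^ ?k"
          using i by (subst sum.remove[OF K i(1)]) (simp only: indicator_simps mem_Collect_eq mult_1_right add_0_right simp_thms)
        also obtain u where u: "u \<in> U" "\<forall>l\<in>U. x l \<le> x u"
        proof -
          have fU: "finite U" using K U(1) finite_subset by blast
          then have "Max (x ` U) \<in> x ` U" using U(2) by (intro Max_in) auto
          then obtain u where "u \<in> U" "Max (x ` U) = x u" by auto
          moreover have "\<forall>l\<in>U. x l \<le> Max (x ` U)" using fU by auto
          ultimately show ?thesis using that by metis
        qed
        have "x u \<le> x i + c i"
          using i u(1) U(1) c(2)[OF u(1)] by (cases "u = i") (auto dest!: bspec[of _ _ u])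
        then have "?r (x i + c i) ^ ?k \<le> ?r (x u) ^ ?k"
          by (intro power_mono ennreal_leI cond_cdf_antimono) auto
        also have "\<dots> = ?r (x u) ^ ?k * indicator {x. \<forall>l\<in>K-{u}. ?C u l (x u) (x l)} x"
          using u by (simp add: indicator_def)
        also have "\<dots> \<le> (\<Sum>u\<in>U. ?r (x u) ^ ?k * indicator {x. \<forall>l\<in>K-{u}. ?C u l (x u) (x l)} x)"
          by (rule member_le_sum) (use u(1) finite_subset[OF U(1) K] in auto)
        finally show ?thesis .
      next
        case False
        then have "(\<Sum>i\<in>K. ?r (x i + c i) ^ ?k * indicator {x. \<forall>l\<in>K-{i}. ?B i l (x i) (x l)} x) = 0"
          by (intro sum.neutral) (simp add: indicator_def)
        then show ?thesis by (simp only: zero_le)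
      qed
    qed
  qed
  also have "\<dots> = (\<Sum>u\<in>U. \<integral>\<^sup>+y. ?r y ^ ?k * (\<Prod>l\<in>K-{u}. emeasure M {z. ?C u l y z}) \<partial>M)"
    by (rule nn_integral_PiM_sum_given_coordinate) (use K U C in auto)
  \<comment> \<open>Bidders outside \<open>U\<close> give the factor \<open>1\<close>; the
    \<open>?k\<close> factors from \<open>U - {u}\<close> absorb the powers of \<open>?r y\<close>
    and undo the conditioning.\<close>
  also have "\<dots> \<le> (\<Sum>u\<in>U. \<integral>\<^sup>+y. emeasure M {..min s y} ^ ?k \<partial>M)"
  proof (intro sum_mono nn_integral_mono)
    fix u y assume u: "u \<in> U"
    have "(\<Prod>l\<in>K-{u}. emeasure M {z. ?C u l y z}) = (\<Prod>l\<in>K-{u}. if l \<in> U then emeasure M {z. z \<le> y} else 1)"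
      using emeasure_space_1 by (intro prod.cong) auto
    also have "\<dots> = emeasure M {z. z \<le> y} ^ ?k"
    proof -
      have "(K - {u}) \<inter> {l. l \<in> U} = U - {u}" using U(1) by auto
      then show ?thesis using K u by (simp add: prod.If_cases)
    qed
    finally have "?r y ^ ?k * (\<Prod>l\<in>K-{u}. emeasure M {z. ?C u l y z}) = (?r y * emeasure M {z. z \<le> y}) ^ ?k"
      by (simp add: power_mult_distrib)
    also have "\<dots> \<le> emeasure M {..min s y} ^ ?k"
      by (intro power_mono cond_cdf_mult_le) auto
    finally show "?r y ^ ?k * (\<Prod>l\<in>K-{u}. emeasure M {z. ?C u l y z}) \<le> emeasure M {..min s y} ^ ?k" .
  qed
  also have "\<dots> = of_nat (card U) * (\<integral>\<^sup>+y. emeasure M {..min s y} ^ ?k \<partial>M)"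
    by simp
  finally show ?thesis .
qed

text \<open>Both distribution functions are compared with the same integral, which depends only on
  the common cardinality of \<open>U\<close> and \<open>N\<close>. Here \<open>r\<close> is a price
  at least as high as the value of every competitor of the winner.\<close>

lemma nn_integral_second_max_le:
  fixes K U :: "'i set" and N :: "'k set" and c :: "'i \<Rightarrow> real"
  assumes K: "finite K" and U: "U \<subseteq> K" "card U = card N" and atomless: "\<And>a. emeasure M {a} = 0"
    and N: "finite N" "2 \<le> card N"
    and c: "\<And>i. i \<in> K \<Longrightarrow> c i \<le> 0" "\<And>i. i \<in> U \<Longrightarrow> c i = 0"
    and R: "\<And>i. i \<in> K \<Longrightarrow> R i \<subseteq> K - {i}" "\<And>i. i \<in> K \<Longrightarrow> card (R i) = card U - 1"
    and r[measurable]: "r \<in> borel_measurable (PiM K (\<lambda>_. M))"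
    and winner: "AE x in PiM K (\<lambda>_. M).
      \<exists>i\<in>K. (\<forall>l\<in>K. x l + c l \<le> x i + c i) \<and> (\<forall>l\<in>R i. x l \<le> r x)"
  shows "(\<integral>\<^sup>+x. ennreal (second_max N x) \<partial>PiM N (\<lambda>_. M)) \<le> (\<integral>\<^sup>+x. ennreal (r x) \<partial>PiM K (\<lambda>_. M))"
proof (rule nn_integral_mono_stochastic_dominance)
  fix s
  have "emeasure (PiM K (\<lambda>_. M)) {x\<in>space (PiM K (\<lambda>_. M)). r x \<le> s} \<le>
      of_nat (card U) * (\<integral>\<^sup>+y. emeasure M {..min s y} ^ (card U - 1) \<partial>M)"
  proof (rule emeasure_losers_le[OF K U(1) _ atomless c R])
    show "AE x in PiM K (\<lambda>_. M). x \<in> {x\<in>space (PiM K (\<lambda>_. M)). r x \<le> s} \<longrightarrow>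
      (\<exists>i\<in>K. (\<forall>l\<in>K. x l + c l \<le> x i + c i) \<and> (\<forall>l\<in>R i. x l \<le> s))"
      using winner by eventually_elim force
  qed (use U(2) N in auto)
  also have "\<dots> \<le> emeasure (PiM N (\<lambda>_. M)) {x\<in>space (PiM N (\<lambda>_. M)). second_max N x \<le> s}"
    unfolding U(2) by (rule emeasure_second_max_ge[OF N atomless])
  finally show "emeasure (PiM K (\<lambda>_. M)) {x\<in>space (PiM K (\<lambda>_. M)). r x \<le> s} \<le>
    emeasure (PiM N (\<lambda>_. M)) {x\<in>space (PiM N (\<lambda>_. M)). second_max N x \<le> s}" .
next
  show "prob_space (PiM K (\<lambda>_. M))" "prob_space (PiM N (\<lambda>_. M))"
    by (rule prob_space_PiM, rule prob_space_axioms)+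
  show "second_max N \<in> borel_measurable (PiM N (\<lambda>_. M))"
    using borel_measurable_second_max[of N "\<lambda>x. x" "PiM N (\<lambda>_. M)"] N(1) by simp
qed (rule r)

end

section \<open>VCG revenue\<close>

text \<open>Taking the least maximizer makes the choice depend only on the values within
  \<open>S\<close>, and keeps it measurable.\<close>

definition pick :: "nat set \<Rightarrow> (nat \<Rightarrow> real) \<Rightarrow> nat" where
  "pick S g = (LEAST l. l \<in> S \<and> (\<forall>l'\<in>S. g l' \<le> g l))"

lemma pick:
  assumes "finite S" "S \<noteq> {}"
  shows "pick S g \<in> S" "l \<in> S \<Longrightarrow> g l \<le> g (pick S g)"
proof -
  have "Max (g ` S) \<in> g ` S" using assms by (intro Max_in) auto
  then obtain k where k: "k \<in> S" "g k = Max (g ` S)" by auto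
  then have "k \<in> S \<and> (\<forall>l'\<in>S. g l' \<le> g k)" using assms by auto
  then have "pick S g \<in> S \<and> (\<forall>l'\<in>S. g l' \<le> g (pick S g))"
    unfolding pick_def by (rule LeastI)
  then show "pick S g \<in> S" "l \<in> S \<Longrightarrow> g l \<le> g (pick S g)" by auto
qed

lemma pick_cong: "S = S' \<Longrightarrow> (\<And>l. l \<in> S' \<Longrightarrow> g l = g' l) \<Longrightarrow> pick S g = pick S' g'"
  unfolding pick_def by (rule arg_cong[of _ _ Least]) auto

text \<open>Summing the welfare of the others counts each bidder's own value
  \<open>card N - 1\<close> times. The allocation thus enters only through its total welfare, which
  is maximal.\<close>

lemma vcg_revenue_eq:
  assumes "finite N" "finite M" "N \<noteq> {}"
    and "is_arg_max (welfare w N) (\<lambda>X. X \<in> allocations N M) X"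
  shows "vcg_revenue w N M X =
    (\<Sum>i\<in>N. max_welfare w (N - {i}) M) - (real (card N) - 1) * max_welfare w N M"
proof -
  have X: "X \<in> allocations N M" "\<And>Y. Y \<in> allocations N M \<Longrightarrow> welfare w N Y \<le> welfare w N X"
    using assms(4) by (auto simp: is_arg_max_linorder)
  have max: "max_welfare w N M = welfare w N X"
    unfolding max_welfare_def by (rule Max_eqI) (use X finite_allocations assms in auto)
  have "(\<Sum>i\<in>N. welfare w (N - {i}) X) = (\<Sum>i\<in>N. welfare w N X - w i (X i))"
    using assms(1) by (intro sum.cong) (auto simp: welfare_def sum.remove)
  also have "\<dots> = (real (card N) - 1) * welfare w N X"
    by (simp add: sum_subtractf welfare_def algebra_simps)
  finally show ?thesis
    by (simp add: vcg_revenue_def vcg_payment_def sum_subtractf max)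
qed

lemma welfare_le_max_welfare:
  "finite N \<Longrightarrow> finite M \<Longrightarrow> X \<in> allocations N M \<Longrightarrow> welfare w N X \<le> max_welfare w N M"
  unfolding max_welfare_def by (intro Max_ge) (auto intro: finite_allocations)

lemma max_welfare_le:
  assumes "finite N" "finite M" "\<And>X. X \<in> allocations N M \<Longrightarrow> welfare w N X \<le> b"
  shows "max_welfare w N M \<le> b"
proof -
  have "(\<lambda>i\<in>N. {}) \<in> allocations N M"
    by (auto simp: allocations_def disjoint_family_on_def)
  then show ?thesis
    unfolding max_welfare_def using assms finite_allocations by (subst Max_le_iff) auto
qed

lemma fibre_allocation:
  "(\<lambda>i\<in>N. {j\<in>M. \<sigma> j = i}) \<in> allocations N M"
  by (auto simp: allocations_def disjoint_family_on_def)

lemma vcg_revenue_single_bidder: "vcg_revenue w {i} M X = 0"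
  by (simp add: vcg_revenue_def vcg_payment_def max_welfare_def welfare_def allocations_def
      disjoint_family_on_def)

section \<open>Additive bidders\<close>

text \<open>Welfare separates over items, and so does the revenue: for each item, only removing the
  highest bidder can lower the maximum, to the second highest value.\<close>

lemma vcg_revenue_additive_le:
  assumes N: "finite N" "2 \<le> card N" and M: "finite M"
    and v: "\<And>i j. i \<in> N \<Longrightarrow> j \<in> M \<Longrightarrow> 0 \<le> v i j"
    and X: "is_arg_max (welfare (\<lambda>i. additive_val (v i)) N) (\<lambda>X. X \<in> allocations N M) X"
  shows "vcg_revenue (\<lambda>i. additive_val (v i)) N M X \<le> (\<Sum>j\<in>M. second_max N (\<lambda>i. v i j))"
proof -
  let ?w = "\<lambda>i. additive_val (v i)"
  let ?m = "\<lambda>S j. Max ((\<lambda>i. v i j) ` S)"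
  have ne: "N \<noteq> {}" using N by auto
  have ne': "N - {i} \<noteq> {}" if "i \<in> N" for i
  proof -
    have "card (N - {i}) \<noteq> 0" using N that by simp
    then show ?thesis by (metis card.empty)
  qed
  \<comment> \<open>Bounds in opposite directions suffice, since \<open>max_welfare\<close> enters
    positively for \<open>N - {i}\<close> and with factor \<open>1 - card N\<close> for
    \<open>N\<close>.\<close>
  have upper: "max_welfare ?w (N - {i}) M \<le> (\<Sum>j\<in>M. ?m (N - {i}) j)" if i: "i \<in> N" for i
  proof (rule max_welfare_le)
    fix Y assume "Y \<in> allocations (N - {i}) M"
    then have Y: "\<And>k. k \<in> N - {i} \<Longrightarrow> Y k \<subseteq> M" "disjoint_family_on Y (N - {i})"
      by (auto simp: allocations_def PiE_iff)
    have m: "0 \<le> ?m (N - {i}) j" if j: "j \<in> M" for j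
    proof -
      obtain k where "k \<in> N - {i}" using ne'[OF i] by blast
      then have "0 \<le> v k j" "v k j \<le> ?m (N - {i}) j" using v j N by (auto intro!: Max_ge)
      then show ?thesis by simp
    qed
    have "welfare ?w (N - {i}) Y \<le> (\<Sum>k\<in>N-{i}. \<Sum>j\<in>Y k. ?m (N - {i}) j)"
      unfolding welfare_def additive_val_def using N by (intro sum_mono Max_ge) auto
    also have "\<dots> = (\<Sum>j\<in>\<Union>(Y ` (N - {i})). ?m (N - {i}) j)"
      using Y N M by (intro sum.UNION_disjoint_family[symmetric]) (auto dest: finite_subset)
    also have "\<dots> \<le> (\<Sum>j\<in>M. ?m (N - {i}) j)"
      using Y M m by (intro sum_mono2) auto
    finally show "welfare ?w (N - {i}) Y \<le> (\<Sum>j\<in>M. ?m (N - {i}) j)" .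
  qed (use N M in auto)
  have lower: "(\<Sum>j\<in>M. ?m N j) \<le> max_welfare ?w N M"
  proof -
    let ?s = "\<lambda>j. pick N (\<lambda>i. v i j)"
    let ?X = "\<lambda>i\<in>N. {j\<in>M. ?s j = i}"
    have "(\<Sum>j\<in>M. ?m N j) = (\<Sum>j\<in>M. v (?s j) j)"
    proof (intro sum.cong refl Max_eqI)
      fix j y assume "y \<in> (\<lambda>i. v i j) ` N"
      then show "y \<le> v (?s j) j" using pick(2)[OF N(1) ne, of _ "\<lambda>i. v i j"] by auto
    qed (use N(1) pick(1)[OF N(1) ne] in auto)
    also have "\<dots> = (\<Sum>i\<in>N. \<Sum>j\<in>{j\<in>M. ?s j = i}. v (?s j) j)"
      using N M pick[OF N(1) ne] by (intro sum.group[symmetric]) auto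
    also have "\<dots> = welfare ?w N ?X"
      unfolding welfare_def additive_val_def by (intro sum.cong) auto
    also have "\<dots> \<le> max_welfare ?w N M"
      by (intro welfare_le_max_welfare fibre_allocation N M)
    finally show ?thesis .
  qed
  \<comment> \<open>The term of the \<open>k\<close> attaining the minimum in
    \<open>second_max\<close> is kept; the others are bounded by the overall maximum and
    cancel.\<close>
  have item: "(\<Sum>i\<in>N. ?m (N - {i}) j) - (real (card N) - 1) * ?m N j \<le> second_max N (\<lambda>i. v i j)" for j
  proof -
    have "second_max N (\<lambda>i. v i j) \<in> (\<lambda>i. ?m (N - {i}) j) ` N"
      unfolding second_max_def using N ne by (intro Min_in) auto
    then obtain k where k: "k \<in> N" "second_max N (\<lambda>i. v i j) = ?m (N - {k}) j" by auto
    have "(\<Sum>i\<in>N-{k}. ?m (N - {i}) j) \<le> (\<Sum>i\<in>N-{k}. ?m N j)"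
      using N ne' by (intro sum_mono Max_mono) auto
    also have "\<dots> = (real (card N) - 1) * ?m N j"
      using N k by simp
    finally show ?thesis using k N by (simp add: sum.remove[of N k])
  qed
  have "vcg_revenue ?w N M X =
      (\<Sum>i\<in>N. max_welfare ?w (N - {i}) M) - (real (card N) - 1) * max_welfare ?w N M"
    by (rule vcg_revenue_eq[OF N(1) M ne X])
  also have "\<dots> \<le> (\<Sum>i\<in>N. \<Sum>j\<in>M. ?m (N - {i}) j) - (real (card N) - 1) * (\<Sum>j\<in>M. ?m N j)"
    using N(2) by (intro diff_mono sum_mono upper mult_left_mono lower) auto
  also have "\<dots> = (\<Sum>j\<in>M. (\<Sum>i\<in>N. ?m (N - {i}) j) - (real (card N) - 1) * ?m N j)"
    by (subst sum.swap) (simp add: sum_subtractf sum_distrib_left)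
  also have "\<dots> \<le> (\<Sum>j\<in>M. second_max N (\<lambda>i. v i j))"
    by (intro sum_mono item)
  finally show ?thesis .
qed

section \<open>Reassigning items to losers\<close>

text \<open>
  Working through the items in order, each item \<open>j\<close> goes to a loser who values it most, except
  those who already took another item from the winner of \<open>j\<close>. So when one bidder is removed, every
  loser takes at most one of her items, which is feasible. Given \<open>\<sigma>\<close>, the competitors for \<open>j\<close>
  depend only on the values for the other items.
\<close>

function reassign :: "nat set \<Rightarrow> nat set \<Rightarrow> (nat \<Rightarrow> nat) \<Rightarrow> (nat \<Rightarrow> nat \<Rightarrow> real) \<Rightarrow> nat \<Rightarrow> nat" where
  "reassign K M \<sigma> v j =
     pick (K - \<sigma> ` M - (\<lambda>j'. reassign K M \<sigma> v j') ` {j'\<in>M. j' < j \<and> \<sigma> j' = \<sigma> j}) (\<lambda>l. v l j)"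
  by auto
termination by (relation "Wellfounded.measure (\<lambda>(K, M, \<sigma>, v, j). j)") auto

declare reassign.simps[simp del]

definition candidates :: "nat set \<Rightarrow> nat set \<Rightarrow> (nat \<Rightarrow> nat) \<Rightarrow> (nat \<Rightarrow> nat \<Rightarrow> real) \<Rightarrow> nat \<Rightarrow> nat set" where
  "candidates K M \<sigma> v j = K - \<sigma> ` M - reassign K M \<sigma> v ` {j'\<in>M. j' < j \<and> \<sigma> j' = \<sigma> j}"

lemma reassign_eq_pick: "reassign K M \<sigma> v j = pick (candidates K M \<sigma> v j) (\<lambda>l. v l j)"
  unfolding candidates_def by (subst reassign.simps) simp

lemma candidates_subset: "candidates K M \<sigma> v j \<subseteq> K - \<sigma> ` M"
  by (auto simp: candidates_def)

text \<open>Each earlier item of the same winner excludes at most one further loser, but adds no new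
  winner. So the two kinds of exclusion together number at most \<open>card M\<close>.\<close>

lemma card_candidates:
  assumes "finite K" "finite M" "j \<in> M"
  shows "card K \<le> card (candidates K M \<sigma> v j) + card M"
proof -
  let ?P = "{j'\<in>M. j' < j \<and> \<sigma> j' = \<sigma> j}"
  have "\<sigma> ` M \<subseteq> \<sigma> ` (M - ?P)" using assms(3) by (auto simp: image_iff)
  then have "card (\<sigma> ` M) \<le> card (M - ?P)"
    using assms by (meson card_image_le card_mono finite_Diff finite_imageI le_trans)
  also have "\<dots> = card M - card ?P" using assms by (intro card_Diff_subset) auto
  finally have 1: "card (\<sigma> ` M) + card ?P \<le> card M"
    using assms card_mono[of M ?P] by auto
  have "card (reassign K M \<sigma> v ` ?P) \<le> card ?P" using assms by (intro card_image_le) auto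
  moreover have "card K - card (\<sigma> ` M) - card (reassign K M \<sigma> v ` ?P) \<le> card (candidates K M \<sigma> v j)"
    unfolding candidates_def using assms
    by (intro order_trans[OF diff_le_mono[OF diff_card_le_card_Diff] diff_card_le_card_Diff]) auto
  ultimately show ?thesis using 1 by linarith
qed

lemma reassign_cong:
  assumes "\<And>l j'. l \<in> K \<Longrightarrow> j' \<le> j \<Longrightarrow> v l j' = v' l j'"
  shows "reassign K M \<sigma> v j = reassign K M \<sigma> v' j"
  using assms
proof (induction j rule: less_induct)
  case (less j)
  have "reassign K M \<sigma> v j' = reassign K M \<sigma> v' j'" if "j' < j" for j'
    by (rule less.IH[OF that]) (use less.prems that in auto)
  then have "candidates K M \<sigma> v j = candidates K M \<sigma> v' j"
    unfolding candidates_def by (intro arg_cong2[of _ _ _ _ "(-)"] refl image_cong) auto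
  then show ?case
    unfolding reassign_eq_pick
    using candidates_subset less.prems by (intro pick_cong) blast+
qed

lemma candidates_cong:
  assumes "\<And>l j'. l \<in> K \<Longrightarrow> j' \<noteq> j \<Longrightarrow> v l j' = v' l j'"
  shows "candidates K M \<sigma> v j = candidates K M \<sigma> v' j"
  unfolding candidates_def using assms
  by (intro arg_cong2[of _ _ _ _ "(-)"] refl image_cong reassign_cong) auto

section \<open>Feasible assignments and a canonical optimum\<close>

locale market =
  fixes K M :: "nat set" and \<I> :: "nat set set"
  assumes K: "finite K" "0 \<notin> K" and M: "finite M" "M \<noteq> {}"
    and dc: "downward_closed_system M \<I>" and singletons: "\<And>j. j \<in> M \<Longrightarrow> {j} \<in> \<I>"
begin

text \<open>In an assignment of items to bidders, \<open>0\<close> stands for ``unassigned''.\<close>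

definition assignments :: "(nat \<Rightarrow> nat) set" where
  "assignments = {\<sigma> \<in> M \<rightarrow>\<^sub>E insert 0 K. \<forall>i\<in>K. {j\<in>M. \<sigma> j = i} \<in> \<I>}"

text \<open>The set \<open>S\<close> of counted items is a parameter, so that the value on
  \<open>M - {j}\<close> can be split off.\<close>

definition assignment_value :: "nat set \<Rightarrow> (nat \<Rightarrow> nat) \<Rightarrow> (nat \<Rightarrow> nat \<Rightarrow> real) \<Rightarrow> real" where
  "assignment_value S \<sigma> v = (\<Sum>j\<in>{j\<in>S. \<sigma> j \<noteq> 0}. v (\<sigma> j) j)"

text \<open>Choosing the least index in an enumeration makes the optimal assignment measurable and
  breaks ties consistently between different profiles.\<close>

definition best_index :: "(nat \<Rightarrow> nat \<Rightarrow> real) \<Rightarrow> nat" where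
  "best_index v = (LEAST k. \<forall>k'. assignment_value M (from_nat_into assignments k') v \<le>
     assignment_value M (from_nat_into assignments k) v)"

abbreviation best :: "(nat \<Rightarrow> nat \<Rightarrow> real) \<Rightarrow> nat \<Rightarrow> nat" where
  "best v \<equiv> from_nat_into assignments (best_index v)"

lemma empty_feasible: "{} \<in> \<I>"
proof -
  obtain j where "j \<in> M" using M(2) by blast
  then show ?thesis
    using dc singletons[of j] unfolding downward_closed_system_def by blast
qed

lemma bidder_pos: "i \<in> K \<Longrightarrow> 0 < i"
  using K(2) by (cases "i = 0") auto

lemma finite_assignments: "finite assignments"
  unfolding assignments_def 
  by (rule finite_subset[OF _ finite_PiE[of M "\<lambda>_. insert 0 K"]]) (use K M in auto)

lemma null_assignment: "(\<lambda>j\<in>M. 0) \<in> assignments"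
proof -
  have "{j\<in>M. (\<lambda>j\<in>M. 0) j = i} = {}" if "i \<in> K" for i :: nat
    using bidder_pos[OF that] by auto
  then have "\<forall>i\<in>K. {j\<in>M. (\<lambda>j\<in>M. 0) j = i} \<in> \<I>" using empty_feasible by metis
  then show ?thesis by (simp add: assignments_def)
qed

lemma single_assignment:
  assumes "j \<in> M" "i \<in> K" shows "(\<lambda>j'\<in>M. if j' = j then i else 0) \<in> assignments"
proof -
  have "{j' \<in> M. (\<lambda>j'\<in>M. if j' = j then i else 0) j' = i'} = (if i' = i then {j} else {})"
    if "i' \<in> K" for i'
    using assms(1) bidder_pos[OF that] by auto
  then show ?thesis
    using assms singletons empty_feasible by (auto simp: assignments_def simp del: restrict_apply)
qed

text \<open>Bidder \<open>i\<close> ends up with \<open>{j}\<close> alone, and all other bundles can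
  only shrink.\<close>

lemma assignment_update_loser:
  assumes "\<sigma> \<in> assignments" "j \<in> M" "i \<in> K" "i \<notin> \<sigma> ` (M - {j})"
  shows "\<sigma>(j := i) \<in> assignments"
proof -
  have "{j'\<in>M. (\<sigma>(j := i)) j' = i'} \<in> \<I>" if i': "i' \<in> K" for i'
  proof (cases "i' = i")
    case True
    then have "{j'\<in>M. (\<sigma>(j := i)) j' = i'} = {j}" using assms by auto
    then show ?thesis using singletons assms by simp
  next
    case False
    then have "{j'\<in>M. (\<sigma>(j := i)) j' = i'} \<subseteq> {j'\<in>M. \<sigma> j' = i'}" by auto
    then show ?thesis
      using dc assms(1) i' unfolding downward_closed_system_def assignments_def by blast
  qed
  moreover have "\<sigma>(j := i) \<in> M \<rightarrow>\<^sub>E insert 0 K"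
    using assms by (auto simp: assignments_def PiE_iff extensional_def)
  ultimately show ?thesis by (auto simp: assignments_def)
qed

lemma range_enum: "range (from_nat_into assignments) = assignments"
  using finite_assignments null_assignment by (intro range_from_nat_into) (auto intro: countable_finite)

lemma best_index:
  "assignment_value M (from_nat_into assignments k) v \<le> assignment_value M (best v) v"
proof -
  let ?f = "\<lambda>\<sigma>. assignment_value M \<sigma> v"
  have "Max (?f ` assignments) \<in> ?f ` assignments"
    using finite_assignments null_assignment by (intro Max_in) auto
  then obtain k where k: "?f (from_nat_into assignments k) = Max (?f ` assignments)"
    using range_enum by (metis (no_types, lifting) imageE)
  have "\<forall>k'. ?f (from_nat_into assignments k') \<le> ?f (from_nat_into assignments k)"
    unfolding k using finite_assignments range_enum by (auto intro!: Max_ge)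
  then have "\<forall>k'. ?f (from_nat_into assignments k') \<le> ?f (best v)"
    unfolding best_index_def by (rule LeastI)
  then show ?thesis by blast
qed

lemma best_index_le:
  assumes "\<forall>k'. assignment_value M (from_nat_into assignments k') v \<le>
    assignment_value M (from_nat_into assignments k) v"
  shows "best_index v \<le> k"
  unfolding best_index_def using assms by (intro Least_le)

lemma best_in: "best v \<in> assignments"
  using range_enum by blast

lemma best_max:
  assumes "\<sigma> \<in> assignments" shows "assignment_value M \<sigma> v \<le> assignment_value M (best v) v"
proof -
  from assms have "\<sigma> \<in> range (from_nat_into assignments)" by (simp only: range_enum)
  then obtain k where "\<sigma> = from_nat_into assignments k" by blast
  then show ?thesis by (simp only: best_index)
qed

lemma assignment_value_split:
  assumes "j \<in> M"
  shows "assignment_value M \<sigma> v = (if \<sigma> j = 0 then 0 else v (\<sigma> j) j) + assignment_value (M - {j}) \<sigma> v"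
proof (cases "\<sigma> j = 0")
  case True
  then have "{j\<in>M. \<sigma> j \<noteq> 0} = {j'\<in>M - {j}. \<sigma> j' \<noteq> 0}" by auto
  with True show ?thesis by (simp add: assignment_value_def)
next
  case False
  then have "{j\<in>M. \<sigma> j \<noteq> 0} = insert j {j'\<in>M - {j}. \<sigma> j' \<noteq> 0}" using assms by auto
  with False M show ?thesis by (simp add: assignment_value_def)
qed

lemma assignment_value_cong:
  assumes "\<sigma> \<in> assignments" "S \<subseteq> M" "\<And>i j. i \<in> K \<Longrightarrow> j \<in> S \<Longrightarrow> v i j = v' i j"
  shows "assignment_value S \<sigma> v = assignment_value S \<sigma> v'"
  unfolding assignment_value_def
proof (rule sum.cong)
  fix j assume j: "j \<in> {j\<in>S. \<sigma> j \<noteq> 0}"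
  then have "j \<in> M" "\<sigma> j \<noteq> 0" using assms(2) by auto
  then have "\<sigma> j \<in> K" using assms(1) by (auto simp: assignments_def PiE_iff)
  then show "v (\<sigma> j) j = v' (\<sigma> j) j" using assms(3) j by auto
qed simp

text \<open>Both optima give \<open>j\<close> to \<open>i\<close>, so the value of \<open>j\<close>
  cancels when they are compared, and the rest is the same for both profiles. Each optimum is
  therefore optimal for the other profile too, and the least index decides.\<close>

lemma best_eq_if_same_winner:
  assumes "j \<in> M" and vv': "\<And>l j'. l \<in> K \<Longrightarrow> j' \<noteq> j \<Longrightarrow> v l j' = v' l j'"
    and "best v j = i" "best v' j = i" "i \<in> K"
  shows "best v = best v'"
proof -
  have i0: "i \<noteq> 0" using bidder_pos[OF assms(5)] by simp
  have rest: "assignment_value (M - {j}) \<sigma> v = assignment_value (M - {j}) \<sigma> v'" if "\<sigma> \<in> assignments" for \<sigma>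
    by (rule assignment_value_cong[OF that]) (use vv' in auto)
  have "assignment_value M (best v') v \<le> assignment_value M (best v) v"
    "assignment_value M (best v) v' \<le> assignment_value M (best v') v'"
    by (intro best_max best_in)+
  then have eq: "assignment_value (M - {j}) (best v) v = assignment_value (M - {j}) (best v') v"
    using assms rest[OF best_in] i0 by (simp add: assignment_value_split[OF assms(1)])
  then have "assignment_value M (best v') v = assignment_value M (best v) v"
    "assignment_value M (best v) v' = assignment_value M (best v') v'"
    using assms rest[OF best_in] by (simp_all add: assignment_value_split[OF assms(1)])
  then have "\<forall>k. assignment_value M (from_nat_into assignments k) v \<le> assignment_value M (best v') v"
    "\<forall>k. assignment_value M (from_nat_into assignments k) v' \<le> assignment_value M (best v) v'"
    using best_index by simp_all
  then have "best_index v \<le> best_index v'" "best_index v' \<le> best_index v"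
    by (blast intro: best_index_le)+
  then show ?thesis by simp
qed

section \<open>Assignments, maximum welfare and a lower bound on the revenue\<close>

text \<open>With \<open>N = K - {i}\<close>, any feasible assignment avoiding \<open>i\<close>
  bounds the welfare without her from below.\<close>

lemma assignment_value_le_max_welfare:
  assumes "\<sigma> \<in> assignments" "N \<subseteq> K" "\<sigma> ` M \<subseteq> insert 0 N"
  shows "assignment_value M \<sigma> v \<le> max_welfare (\<lambda>i. additive_subject_to \<I> (v i)) N M"
proof -
  let ?w = "\<lambda>i. additive_subject_to \<I> (v i)" and ?X = "\<lambda>i\<in>N. {j\<in>M. \<sigma> j = i}"
  have N: "finite N" "0 \<notin> N" using assms(2) K finite_subset by auto
  have finI: "finite \<I>" using dc M unfolding downward_closed_system_def by (meson finite_Pow_iff finite_subset)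
  have "assignment_value M \<sigma> v = (\<Sum>i\<in>N. \<Sum>j\<in>{j\<in>{j\<in>M. \<sigma> j \<noteq> 0}. \<sigma> j = i}. v (\<sigma> j) j)"
    unfolding assignment_value_def using N M assms(3) by (intro sum.group[symmetric]) auto
  also have "\<dots> \<le> welfare ?w N ?X"
    unfolding welfare_def
  proof (rule sum_mono)
    fix i assume i: "i \<in> N"
    have "(\<Sum>j\<in>{j\<in>{j\<in>M. \<sigma> j \<noteq> 0}. \<sigma> j = i}. v (\<sigma> j) j) = (\<Sum>j\<in>{j\<in>M. \<sigma> j = i}. v i j)"
      using bidder_pos[of i] i assms(2) by (intro sum.cong) auto
    also have "\<dots> \<le> ?w i {j\<in>M. \<sigma> j = i}"
      unfolding additive_subject_to_def
      using finI assms i by (intro Max_ge) (auto simp: assignments_def)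
    finally show "(\<Sum>j\<in>{j\<in>{j\<in>M. \<sigma> j \<noteq> 0}. \<sigma> j = i}. v (\<sigma> j) j) \<le> ?w i (?X i)"
      using i by simp
  qed
  also have "\<dots> \<le> max_welfare ?w N M"
    by (intro welfare_le_max_welfare fibre_allocation N M)
  finally show ?thesis .
qed

text \<open>A bidder's value for her bundle is attained on a feasible part of it; assigning only
  these parts loses nothing.\<close>

lemma max_welfare_le_best:
  "max_welfare (\<lambda>i. additive_subject_to \<I> (v i)) K M \<le> assignment_value M (best v) v"
proof (rule max_welfare_le[OF K(1) M(1)])
  fix X assume "X \<in> allocations K M"
  then have X: "\<And>i. i \<in> K \<Longrightarrow> X i \<subseteq> M" "disjoint_family_on X K"
    by (auto simp: allocations_def PiE_iff)
  have finI: "finite \<I>" using dc M unfolding downward_closed_system_def by (meson finite_Pow_iff finite_subset)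
  have "\<exists>T. T \<in> \<I> \<and> T \<subseteq> X i \<and> additive_subject_to \<I> (v i) (X i) = (\<Sum>j\<in>T. v i j)" for i
  proof -
    have "additive_subject_to \<I> (v i) (X i) \<in> (\<lambda>T. \<Sum>j\<in>T. v i j) ` {T \<in> \<I>. T \<subseteq> X i}"
      unfolding additive_subject_to_def using finI empty_feasible by (intro Max_in) auto
    then show ?thesis by auto
  qed
  then obtain T where T: "\<And>i. T i \<in> \<I>" "\<And>i. T i \<subseteq> X i"
    "\<And>i. additive_subject_to \<I> (v i) (X i) = (\<Sum>j\<in>T i. v i j)" by metis
  \<comment> \<open>The parts \<open>T i\<close> with \<open>i\<close> in \<open>K\<close> are
    disjoint, so \<open>SOME\<close> has only one choice; items in no part stay unassigned.\<close>
  define \<sigma> where "\<sigma> = (\<lambda>j\<in>M. if \<exists>i\<in>K. j \<in> T i then SOME i. i \<in> K \<and> j \<in> T i else 0)"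
  have \<sigma>T: "{j\<in>M. \<sigma> j = i} = T i" if i: "i \<in> K" for i
  proof (intro set_eqI iffI)
    fix j assume "j \<in> {j\<in>M. \<sigma> j = i}"
    then have j: "j \<in> M" "\<sigma> j = i" by auto
    then have "\<exists>i. i \<in> K \<and> j \<in> T i" using i K by (auto simp: \<sigma>_def split: if_splits)
    from someI_ex[OF this] show "j \<in> T i" using j i K by (auto simp: \<sigma>_def split: if_splits)
  next
    fix j assume j: "j \<in> T i"
    then have jM: "j \<in> M" using T(2) X(1) i by blast
    have "i' = i" if "i' \<in> K \<and> j \<in> T i'" for i'
    proof (rule ccontr)
      assume "i' \<noteq> i"
      then have "X i' \<inter> X i = {}" using disjoint_family_onD[OF X(2)] that i by blast
      then show False using T(2)[of i] T(2)[of i'] j that by blast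
    qed
    with i j have "(SOME i. i \<in> K \<and> j \<in> T i) = i" by (intro some_equality conjI)
    moreover have "\<exists>i\<in>K. j \<in> T i" using i j by blast
    ultimately show "j \<in> {j\<in>M. \<sigma> j = i}" using jM by (simp add: \<sigma>_def)
  qed
  have \<sigma>K: "\<sigma> j \<in> insert 0 K" if "j \<in> M" for j
  proof (cases "\<exists>i\<in>K. j \<in> T i")
    case True
    then have "(SOME i. i \<in> K \<and> j \<in> T i) \<in> K" using someI_ex[of "\<lambda>i. i \<in> K \<and> j \<in> T i"] by blast
    then show ?thesis using that True by (simp add: \<sigma>_def)
  qed (use that in \<open>simp add: \<sigma>_def\<close>)
  have "\<sigma> \<in> M \<rightarrow>\<^sub>E insert 0 K"
    by (intro PiE_I \<sigma>K) (simp_all add: \<sigma>_def)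
  then have \<sigma>: "\<sigma> \<in> assignments"
    unfolding assignments_def using T(1) by (simp add: \<sigma>T)
  have "welfare (\<lambda>i. additive_subject_to \<I> (v i)) K X = (\<Sum>i\<in>K. \<Sum>j\<in>T i. v i j)"
    by (simp add: welfare_def T(3))
  also have "\<dots> = (\<Sum>i\<in>K. \<Sum>j\<in>{j\<in>{j\<in>M. \<sigma> j \<noteq> 0}. \<sigma> j = i}. v (\<sigma> j) j)"
  proof (intro sum.cong refl)
    fix i assume i: "i \<in> K"
    show "T i = {j\<in>{j\<in>M. \<sigma> j \<noteq> 0}. \<sigma> j = i}" using \<sigma>T[OF i] bidder_pos[OF i] by auto
  qed auto
  also have "\<dots> = assignment_value M \<sigma> v"
    unfolding assignment_value_def
  proof (rule sum.group)
    show "\<sigma> ` {j\<in>M. \<sigma> j \<noteq> 0} \<subseteq> K"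
    proof (rule image_subsetI)
      fix j assume "j \<in> {j\<in>M. \<sigma> j \<noteq> 0}"
      then show "\<sigma> j \<in> K" using \<sigma>K[of j] by simp
    qed
  qed (use K M in auto)
  also have "\<dots> \<le> assignment_value M (best v) v" by (rule best_max[OF \<sigma>])
  finally show "welfare (\<lambda>i. additive_subject_to \<I> (v i)) K X \<le> assignment_value M (best v) v" .
qed

lemma exists_loser:
  assumes "j \<in> M" "card M < card K" shows "candidates K M \<sigma> v j \<noteq> {}"
  using card_candidates[OF K(1) M(1) assms(1), of \<sigma> v] assms(2) by auto

text \<open>Otherwise a loser, who exists since there are fewer items than bidders, could take
  \<open>j\<close> and add a positive value.\<close>

lemma best_assigns_all:
  assumes "j \<in> M" "card M < card K" "\<And>i. i \<in> K \<Longrightarrow> 0 < v i j"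
  shows "best v j \<in> K"
proof (rule ccontr)
  assume "best v j \<notin> K"
  then have 0: "best v j = 0" using best_in[of v] assms(1) by (auto simp: assignments_def PiE_iff)
  obtain l where l: "l \<in> K" "l \<notin> best v ` M"
    using exists_loser[OF assms(1,2), of "best v" v] candidates_subset by blast
  then have "(best v)(j := l) \<in> assignments"
    by (intro assignment_update_loser best_in assms(1)) auto
  from best_max[OF this, of v]
  have "v l j + assignment_value (M - {j}) ((best v)(j := l)) v \<le> assignment_value (M - {j}) (best v) v"
    using 0 bidder_pos[OF l(1)] by (simp add: assignment_value_split[OF assms(1)])
  moreover have "assignment_value (M - {j}) ((best v)(j := l)) v = assignment_value (M - {j}) (best v) v"
    unfolding assignment_value_def by (rule sum.cong) auto
  ultimately show False using assms(3)[OF l(1)] by simp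
qed

text \<open>Without bidder \<open>i\<close>, her items go to their reassigned losers. Summed over
  \<open>i\<close>, each item counts once at the loser's value and \<open>card K - 1\<close> times
  at the winner's, and the latter cancel against the maximum welfare of all bidders.\<close>

lemma vcg_revenue_ge_reassign:
  assumes "card M < card K" and v: "\<And>i j. i \<in> K \<Longrightarrow> j \<in> M \<Longrightarrow> 0 < v i j"
    and X: "is_arg_max (welfare (\<lambda>i. additive_subject_to \<I> (v i)) K) (\<lambda>X. X \<in> allocations K M) X"
  shows "(\<Sum>j\<in>M. v (reassign K M (best v) v j) j) \<le> vcg_revenue (\<lambda>i. additive_subject_to \<I> (v i)) K M X"
proof -
  let ?w = "\<lambda>i. additive_subject_to \<I> (v i)"
  define \<sigma> where "\<sigma> = best v"
  define a where "a = reassign K M \<sigma> v"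
  have \<sigma>: "\<sigma> \<in> assignments" by (simp add: \<sigma>_def best_in)
  have \<sigma>K: "\<sigma> j \<in> K" if "j \<in> M" for j
    unfolding \<sigma>_def by (rule best_assigns_all[OF that assms(1)]) (use v that in auto)
  have a: "a j \<in> candidates K M \<sigma> v j" if "j \<in> M" for j
  proof -
    have "finite (candidates K M \<sigma> v j)" using candidates_subset K(1) by (meson finite_Diff finite_subset)
    then show ?thesis
      unfolding a_def reassign_eq_pick using exists_loser[OF that assms(1)] by (rule pick(1))
  qed
  have aK: "a j \<in> K" "a j \<notin> \<sigma> ` M" if "j \<in> M" for j
    using a[OF that] candidates_subset by blast+
  have a_inj: "a j \<noteq> a j'" if "j \<in> M" "j' \<in> M" "\<sigma> j' = \<sigma> j" "j' < j" for j j'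
    using a[OF that(1)] that(2-4) by (auto simp: candidates_def a_def)
  have "K \<noteq> {}" using assms(1) by auto
  let ?\<tau> = "\<lambda>i. \<lambda>j\<in>M. if \<sigma> j = i then a j else \<sigma> j"
  have \<tau>: "?\<tau> i \<in> assignments" if i: "i \<in> K" for i
  proof -
    have "{j\<in>M. ?\<tau> i j = i'} \<in> \<I>" if i': "i' \<in> K" for i'
    proof (cases "i' \<in> \<sigma> ` M")
      \<comment> \<open>Winners receive nothing new, so downward closure applies.\<close>
      case True
      have "\<sigma> j = i'" if "j \<in> M" "?\<tau> i j = i'" for j
        using that aK(2)[OF that(1)] True by (cases "\<sigma> j = i") auto
      then have "{j\<in>M. ?\<tau> i j = i'} \<subseteq> {j\<in>M. \<sigma> j = i'}" by blast
      then show ?thesis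
        using dc \<sigma> i' unfolding downward_closed_system_def assignments_def by blast
    next
      \<comment> \<open>A loser receives only items of \<open>i\<close>, and at most one of them by
        \<open>a_inj\<close>.\<close>
      case False
      let ?F = "{j\<in>M. \<sigma> j = i \<and> a j = i'}"
      have F: "{j\<in>M. ?\<tau> i j = i'} = ?F" using False by (auto simp: image_iff split: if_splits)
      have same: "j = j'" if "j \<in> ?F" "j' \<in> ?F" for j j'
        using a_inj[of j j'] a_inj[of j' j] that by (cases j j' rule: linorder_cases) auto
      have "?F \<in> \<I>"
      proof (cases "?F = {}")
        case True
        then show ?thesis using empty_feasible by (simp only:)
      next
        case False
        then obtain j where j: "j \<in> ?F" by blast
        then have "?F = {j}" using same by blast
        moreover have "{j} \<in> \<I>" using j singletons by blast
        ultimately show ?thesis by (simp only:)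
      qed
      then show ?thesis by (simp only: F)
    qed
    then show ?thesis unfolding assignments_def using \<sigma>K aK by (auto simp: PiE_iff)
  qed
  have total: "assignment_value M \<rho> v = (\<Sum>j\<in>M. v (\<rho> j) j)" if "\<And>j. j \<in> M \<Longrightarrow> \<rho> j \<in> K" for \<rho>
  proof -
    have "{j\<in>M. \<rho> j \<noteq> 0} = M" using that bidder_pos by fastforce
    then show ?thesis by (simp add: assignment_value_def)
  qed
  have lower: "(\<Sum>j\<in>M. if \<sigma> j = i then v (a j) j else v (\<sigma> j) j) \<le> max_welfare ?w (K - {i}) M" if i: "i \<in> K" for i
  proof -
    have "(\<Sum>j\<in>M. if \<sigma> j = i then v (a j) j else v (\<sigma> j) j) = assignment_value M (?\<tau> i) v"
      using \<sigma>K aK by (subst total) (auto intro!: sum.cong)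
    also have "\<dots> \<le> max_welfare ?w (K - {i}) M"
      using \<sigma>K aK by (intro assignment_value_le_max_welfare \<tau> i) auto
    finally show ?thesis .
  qed
  have *: "(\<Sum>i\<in>K. if \<sigma> j = i then v (a j) j else v (\<sigma> j) j) = v (a j) j + (real (card K) - 1) * v (\<sigma> j) j"
    if j: "j \<in> M" for j
  proof -
    have "(\<Sum>i\<in>K-{\<sigma> j}. if \<sigma> j = i then v (a j) j else v (\<sigma> j) j) = (\<Sum>i\<in>K-{\<sigma> j}. v (\<sigma> j) j)"
      by (intro sum.cong) auto
    moreover have "1 \<le> card K" using assms(1) by auto
    ultimately show ?thesis using K(1) \<sigma>K[OF j] by (simp add: sum.remove[of K "\<sigma> j"])
  qed
  have "(\<Sum>j\<in>M. v (a j) j) =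
      (\<Sum>i\<in>K. \<Sum>j\<in>M. if \<sigma> j = i then v (a j) j else v (\<sigma> j) j) - (real (card K) - 1) * assignment_value M \<sigma> v"
    using total[of \<sigma>, OF \<sigma>K] by (subst sum.swap) (simp add: * sum.distrib sum_distrib_left)
  also have "\<dots> \<le> (\<Sum>i\<in>K. max_welfare ?w (K - {i}) M) - (real (card K) - 1) * max_welfare ?w K M"
    using assms(1) max_welfare_le_best[of v]
    by (intro diff_mono sum_mono lower mult_left_mono) (auto simp: \<sigma>_def)
  also have "\<dots> = vcg_revenue ?w K M X"
    by (rule vcg_revenue_eq[OF K(1) M(1) \<open>K \<noteq> {}\<close> X, symmetric])
  finally show ?thesis by (simp add: a_def \<sigma>_def)
qed

section \<open>The winner of an item as a highest score\<close>

definition reassigned_value :: "(nat \<Rightarrow> nat \<Rightarrow> real) \<Rightarrow> nat \<Rightarrow> real" where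
  "reassigned_value v j = v (reassign K M (best v) v j) j"

lemma reassigned_value_pos:
  assumes "j \<in> M" "card M < card K" "\<And>i. i \<in> K \<Longrightarrow> 0 < v i j"
  shows "0 < reassigned_value v j"
proof -
  let ?C = "candidates K M (best v) v j"
  have "?C \<subseteq> K" using candidates_subset by blast
  then have "pick ?C (\<lambda>l. v l j) \<in> K"
    using pick(1)[of ?C "\<lambda>l. v l j"] exists_loser[OF assms(1,2)] K(1) finite_subset by blast
  then show ?thesis
    unfolding reassigned_value_def reassign_eq_pick by (rule assms(3))
qed

text \<open>
  With the values for the other items fixed, the winner of \<open>j\<close> determines the whole assignment,
  hence also the set of candidates for \<open>j\<close>. The constant \<open>- c i\<close> is the loss of welfare on the other
  items incurred by giving \<open>j\<close> to \<open>i\<close>.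
\<close>

lemma winner_structure:
  assumes j: "j \<in> M" and card: "card K + 1 = n + card M" "2 \<le> n"
  obtains c :: "nat \<Rightarrow> real" and U R where
    "U \<subseteq> K" "card U = n" "\<And>i. i \<in> K \<Longrightarrow> c i \<le> 0" "\<And>i. i \<in> U \<Longrightarrow> c i = 0"
    "\<And>i. i \<in> K \<Longrightarrow> R i \<subseteq> K - {i}" "\<And>i. i \<in> K \<Longrightarrow> card (R i) = card U - 1"
    "\<forall>x. (\<forall>i\<in>K. 0 < x i) \<longrightarrow>
      (\<exists>i\<in>K. (\<forall>l\<in>K. x l + c l \<le> x i + c i) \<and>
        (\<forall>l\<in>R i. x l \<le> reassigned_value (\<lambda>i\<in>K. (v i)(j := x i)) j))"
proof -
  let ?v = "\<lambda>x. \<lambda>i\<in>K. (v i)(j := x i)"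
  let ?rest = "\<lambda>\<sigma>. assignment_value (M - {j}) \<sigma> v"
  \<comment> \<open>\<open>?b i\<close> is the best value on the other items when \<open>j\<close>
    goes to \<open>i\<close>; \<open>b0\<close> allows \<open>j\<close> to go to anyone or to
    nobody.\<close>
  let ?b = "\<lambda>i. Max (?rest ` {\<sigma>\<in>assignments. \<sigma> j = i})"
  define b0 where "b0 = Max (?rest ` assignments)"
  define c where "c i = ?b i - b0" for i
  have less: "card M < card K" using card by linarith
  have with_ne: "{\<sigma>\<in>assignments. \<sigma> j = i} \<noteq> {}" if "i \<in> K" for i
    using single_assignment[OF j that] j by force
  have rest: "assignment_value (M - {j}) \<sigma> (?v x) = ?rest \<sigma>" if "\<sigma> \<in> assignments" for \<sigma> x
    by (rule assignment_value_cong[OF that]) auto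
  have worth: "assignment_value M \<sigma> (?v x) = x i + ?rest \<sigma>"
    if "\<sigma> \<in> assignments" "\<sigma> j = i" "i \<in> K" for \<sigma> x i
    using bidder_pos[of i] that rest[OF that(1), of x] by (simp add: assignment_value_split[OF j])
  have c_le: "c i \<le> 0" if "i \<in> K" for i
  proof -
    have "?b i \<le> b0"
      unfolding b0_def
    proof (rule Max_mono)
      show "?rest ` {\<sigma>\<in>assignments. \<sigma> j = i} \<noteq> {}" using with_ne[OF that] by simp
    qed (use finite_assignments in auto)
    then show ?thesis by (simp add: c_def)
  qed
  have "b0 \<in> ?rest ` assignments"
    unfolding b0_def
  proof (rule Max_in)
    show "?rest ` assignments \<noteq> {}" using null_assignment by blast
  qed (use finite_assignments in simp)
  then obtain \<tau> where \<tau>: "\<tau> \<in> assignments" "b0 = ?rest \<tau>" by blast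
  \<comment> \<open>The assignment \<open>\<tau>\<close>, optimal on the other items, serves at most
    \<open>card M - 1\<close> bidders there. At least \<open>n\<close> bidders remain who can take
    \<open>j\<close> without loss on the other items.\<close>
  have "n \<le> card (K - \<tau> ` (M - {j}))"
  proof -
    have "card (\<tau> ` (M - {j})) \<le> card (M - {j})" using M by (intro card_image_le) auto
    moreover have "Suc (card (M - {j})) = card M" by (rule card_Suc_Diff1[OF M(1) j])
    moreover have "card K - card (\<tau> ` (M - {j})) \<le> card (K - \<tau> ` (M - {j}))"
      using M by (intro diff_card_le_card_Diff) auto
    ultimately show ?thesis using card(1) by linarith
  qed
  then obtain U where U: "U \<subseteq> K - \<tau> ` (M - {j})" "card U = n"
    using obtain_subset_with_card_n by metis
  have c_U: "c u = 0" if u: "u \<in> U" for u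
  proof -
    have uK: "u \<in> K" "u \<notin> \<tau> ` (M - {j})" using u U by auto
    have "\<tau>(j := u) \<in> assignments" by (rule assignment_update_loser[OF \<tau>(1) j uK])
    moreover have "?rest (\<tau>(j := u)) = b0"
      unfolding \<tau>(2) assignment_value_def by (rule sum.cong) auto
    ultimately have "b0 \<in> ?rest ` {\<sigma>\<in>assignments. \<sigma> j = u}" by (metis (mono_tags, lifting) fun_upd_same imageI mem_Collect_eq)
    then have "b0 \<le> ?b u" using finite_assignments by (intro Max_ge) simp_all
    then show ?thesis using c_le[OF uK(1)] by (simp add: c_def)
  qed
  \<comment> \<open>The winner \<open>i\<close> fixes the whole optimum independently of
    \<open>x\<close>. If \<open>i\<close> never wins, any assignment giving her \<open>j\<close>
    serves, so that \<open>Z i j = i\<close> holds for all \<open>i\<close> in \<open>K\<close> and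
    excludes \<open>i\<close> from her own competitors.\<close>
  have "\<forall>i\<in>K. \<exists>\<sigma>. \<sigma> \<in> assignments \<and> \<sigma> j = i \<and> (\<forall>x. best (?v x) j = i \<longrightarrow> best (?v x) = \<sigma>)"
  proof
    fix i assume i: "i \<in> K"
    show "\<exists>\<sigma>. \<sigma> \<in> assignments \<and> \<sigma> j = i \<and> (\<forall>x. best (?v x) j = i \<longrightarrow> best (?v x) = \<sigma>)"
    proof (cases "\<exists>x. best (?v x) j = i")
      case True
      then obtain x where x: "best (?v x) j = i" by blast
      have "best (?v x') = best (?v x)" if "best (?v x') j = i" for x'
        by (rule best_eq_if_same_winner[OF j _ that x i]) auto
      then show ?thesis using x best_in by blast
    next
      case False
      then show ?thesis using with_ne[OF i] by blast
    qed
  qed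
  from bchoice[OF this] obtain Z where
    Z_all: "\<forall>i\<in>K. Z i \<in> assignments \<and> Z i j = i \<and> (\<forall>x. best (?v x) j = i \<longrightarrow> best (?v x) = Z i)" ..
  have Z: "Z i \<in> assignments" "Z i j = i" "best (?v x) j = i \<Longrightarrow> best (?v x) = Z i"
    if "i \<in> K" for i x
    using bspec[OF Z_all that] by simp_all
  have "\<exists>R. R \<subseteq> candidates K M (Z i) v j \<and> card R = n - 1" for i
  proof -
    have "n - 1 \<le> card (candidates K M (Z i) v j)"
      using card_candidates[OF K(1) M(1) j, of "Z i" v] card by linarith
    then show ?thesis using obtain_subset_with_card_n by metis
  qed
  then obtain R where R: "\<And>i. R i \<subseteq> candidates K M (Z i) v j" "\<And>i. card (R i) = n - 1" by metis
  show thesis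
  proof (rule that[of U c R])
    fix i assume i: "i \<in> K"
    have "i \<in> Z i ` M" using Z(2)[OF i] j by (metis imageI)
    then show "R i \<subseteq> K - {i}" using R(1)[of i] candidates_subset[of K M "Z i" v j] by auto
  next
    show "\<forall>x. (\<forall>i\<in>K. 0 < x i) \<longrightarrow>
      (\<exists>i\<in>K. (\<forall>l\<in>K. x l + c l \<le> x i + c i) \<and> (\<forall>l\<in>R i. x l \<le> reassigned_value (?v x) j))"
    proof (intro allI impI)
      fix x :: "nat \<Rightarrow> real" assume x: "\<forall>i\<in>K. 0 < x i"
      define i where "i = best (?v x) j"
      have i: "i \<in> K"
        unfolding i_def by (rule best_assigns_all[OF j less]) (use x in simp)
      have best: "best (?v x) = Z i" by (rule Z(3)[OF i i_def[symmetric]])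
      \<comment> \<open>The optimum is compared with the best assignment that gives \<open>j\<close>
        to \<open>l\<close>.\<close>
      have "x l + c l \<le> x i + c i" if l: "l \<in> K" for l
      proof -
        have "?b l \<in> ?rest ` {\<sigma>\<in>assignments. \<sigma> j = l}"
        proof (rule Max_in)
          show "?rest ` {\<sigma>\<in>assignments. \<sigma> j = l} \<noteq> {}" using with_ne[OF l] by simp
        qed (use finite_assignments in simp)
        then obtain \<sigma> where \<sigma>: "\<sigma> \<in> assignments" "\<sigma> j = l" "?b l = ?rest \<sigma>" by auto
        have "x l + ?b l = assignment_value M \<sigma> (?v x)" using worth[OF \<sigma>(1,2) l] \<sigma>(3) by simp
        also have "\<dots> \<le> assignment_value M (best (?v x)) (?v x)" by (rule best_max[OF \<sigma>(1)])
        also have "\<dots> = x i + ?rest (best (?v x))" by (rule worth[OF best_in i_def[symmetric] i])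
        also have "?rest (best (?v x)) \<le> ?b i"
        proof (rule Max_ge)
          show "?rest (best (?v x)) \<in> ?rest ` {\<sigma>\<in>assignments. \<sigma> j = i}"
            using best_in i_def by blast
        qed (use finite_assignments in simp)
        finally show ?thesis by (simp add: c_def)
      qed
      moreover have "x l \<le> reassigned_value (?v x) j" if l: "l \<in> R i" for l
      proof -
        let ?C = "candidates K M (Z i) (?v x) j"
        \<comment> \<open>The pool does not see column \<open>j\<close>, so it is still the one from
          which \<open>R i\<close> was chosen.\<close>
        have C: "?C = candidates K M (Z i) v j" by (rule candidates_cong) auto
        then have lC: "l \<in> ?C" using l R(1) by auto
        have CK: "?C \<subseteq> K" using candidates_subset by blast
        then have fin: "finite ?C" using K(1) finite_subset by auto
        let ?p = "pick ?C (\<lambda>l. ?v x l j)"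
        have p: "?v x l j \<le> ?v x ?p j" by (rule pick(2)[OF fin _ lC]) (use lC in auto)
        have "l \<in> K" using CK lC by blast
        then have "x l = ?v x l j" by simp
        also note p
        also have "?v x ?p j = reassigned_value (?v x) j"
          unfolding reassigned_value_def best reassign_eq_pick ..
        finally show ?thesis .
      qed
      ultimately show "\<exists>i\<in>K. (\<forall>l\<in>K. x l + c l \<le> x i + c i) \<and> (\<forall>l\<in>R i. x l \<le> reassigned_value (?v x) j)"
        using i by blast
    qed
  qed (use U c_le c_U R(2) in auto)
qed

section \<open>Measurability of the reassignment\<close>

text \<open>No condition on \<open>l\<close> is imposed: profiles are extensional, so outside
  \<open>K\<close> the entry is the constant \<open>undefined j\<close>.\<close>

lemma measurable_column:
  assumes "j \<in> M" "sets (D j) = sets borel"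
  shows "(\<lambda>v. v l j) \<in> borel_measurable (PiM K (\<lambda>_. PiM M D))"
proof (cases "l \<in> K")
  case True
  have "(\<lambda>v. v l j) \<in> PiM K (\<lambda>_. PiM M D) \<rightarrow>\<^sub>M D j"
    using measurable_compose[OF measurable_component_singleton[OF True] measurable_component_singleton[OF assms(1)]] .
  then show ?thesis using assms(2) by (simp cong: measurable_cong_sets)
next
  case False
  then have "v l j = undefined j" if "v \<in> space (PiM K (\<lambda>_. PiM M D))" for v
    using that by (auto simp: space_PiM PiE_iff extensional_def)
  then show ?thesis by (subst measurable_cong[of _ _ "\<lambda>_. undefined j"]) auto
qed

text \<open>By induction, membership in the pool depends on finitely many earlier reassignments, and
  \<open>pick\<close> is a \<open>LEAST\<close> over measurable conditions.\<close>

lemma measurable_reassign: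
  assumes D: "\<And>j. j \<in> M \<Longrightarrow> sets (D j) = sets borel" and "j \<in> M"
  shows "(\<lambda>v. reassign K M \<sigma> v j) \<in> PiM K (\<lambda>_. PiM M D) \<rightarrow>\<^sub>M count_space UNIV"
  using assms(2)
proof (induction j rule: less_induct)
  case (less j)
  let ?P = "PiM K (\<lambda>_. PiM M D)"
  have mem: "Measurable.pred ?P (\<lambda>v. l \<in> candidates K M \<sigma> v j)" for l
  proof -
    have [measurable]: "Measurable.pred ?P (\<lambda>v. \<forall>j'\<in>{j'\<in>M. j' < j \<and> \<sigma> j' = \<sigma> j}. reassign K M \<sigma> v j' \<noteq> l)"
    proof (rule pred_intros_finite)
      fix j' assume "j' \<in> {j'\<in>M. j' < j \<and> \<sigma> j' = \<sigma> j}"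
      then have [measurable]: "(\<lambda>v. reassign K M \<sigma> v j') \<in> ?P \<rightarrow>\<^sub>M count_space UNIV"
        using less.IH by blast
      show "Measurable.pred ?P (\<lambda>v. reassign K M \<sigma> v j' \<noteq> l)" by measurable
    qed (use M(1) in auto)
    have "(\<lambda>v. l \<in> candidates K M \<sigma> v j) =
        (\<lambda>v. l \<in> K - \<sigma> ` M \<and> (\<forall>j'\<in>{j'\<in>M. j' < j \<and> \<sigma> j' = \<sigma> j}. reassign K M \<sigma> v j' \<noteq> l))"
      by (auto simp: candidates_def fun_eq_iff)
    then show ?thesis by (simp only:) measurable
  qed
  have le: "Measurable.pred ?P (\<lambda>v. v l' j \<le> v l j)" for l l'
    unfolding pred_def by (intro borel_measurable_le measurable_column D less.prems)
  have "Measurable.pred ?P (\<lambda>v. \<forall>l'\<in>candidates K M \<sigma> v j. v l' j \<le> v l j)" for l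
  proof -
    have "(\<lambda>v. \<forall>l'\<in>candidates K M \<sigma> v j. v l' j \<le> v l j) =
        (\<lambda>v. \<forall>l'. l' \<in> candidates K M \<sigma> v j \<longrightarrow> v l' j \<le> v l j)" by auto
    then show ?thesis by (simp only:) (intro pred_intros_countable pred_intros_logic mem le)
  qed
  then show ?case
    unfolding reassign_eq_pick pick_def by (intro measurable_Least pred_intros_logic mem)
qed

text \<open>The optimal index and the reassigned loser are natural numbers, so both can be
  substituted by countable composition.\<close>

lemma measurable_reassigned_value:
  assumes D: "\<And>j. j \<in> M \<Longrightarrow> sets (D j) = sets borel" and j: "j \<in> M"
  shows "(\<lambda>v. reassigned_value v j) \<in> borel_measurable (PiM K (\<lambda>_. PiM M D))"
proof -
  let ?P = "PiM K (\<lambda>_. PiM M D)" and ?e = "from_nat_into assignments"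
  have val: "(\<lambda>v. assignment_value M \<sigma> v) \<in> borel_measurable ?P" for \<sigma>
    unfolding assignment_value_def by (intro borel_measurable_sum measurable_column D) auto
  have idx: "best_index \<in> ?P \<rightarrow>\<^sub>M count_space UNIV"
    unfolding best_index_def[abs_def] pred_def
    by (intro measurable_Least pred_intros_countable) (simp add: pred_def borel_measurable_le val)
  have "(\<lambda>v. v (reassign K M (?e k) v j) j) \<in> borel_measurable ?P" for k
    by (rule measurable_compose_countable[OF measurable_column[where D = D, OF j D[OF j]] measurable_reassign[OF D j]])
  from measurable_compose_countable[OF this idx]
  show ?thesis unfolding reassigned_value_def .
qed

end

section \<open>Expected revenue\<close>

text \<open>A Lebesgue density excludes atoms, in particular at \<open>0\<close>, and it vanishes
  outside \<open>S\<close>, which lies in \<open>{0..}\<close>.\<close>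

lemma regular_distributionD:
  assumes "regular_distribution D"
  shows "real_distribution D" "emeasure D {a} = 0" "AE x in D. 0 < x"
proof -
  obtain f S where D: "prob_space D" "f \<in> borel_measurable borel"
    "D = density lborel (\<lambda>x. ennreal (f x))" "S \<subseteq> {0..}" "\<And>x. x \<notin> S \<Longrightarrow> f x = 0"
    using assms unfolding regular_distribution_def by blast
  have f[measurable]: "(\<lambda>x. ennreal (f x)) \<in> borel_measurable lborel" using D(2) by simp
  have sets: "sets D = sets borel" using D(3) by simp
  interpret prob_space D by fact
  show "real_distribution D" by unfold_locales (rule sets)
  have no_atom: "AE x in D. x \<noteq> b" for b
    unfolding D(3) AE_density[OF f] using AE_lborel_singleton[of b] by eventually_elim simp
  then have "emeasure D {x \<in> space D. x = a} = 0" by (intro emeasure_eq_0_AE) simp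
  moreover have "{x \<in> space D. x = a} = {a}" using sets_eq_imp_space_eq[OF sets] by auto
  ultimately show "emeasure D {a} = 0" by simp
  have "AE x in D. x \<in> S"
    unfolding D(3) AE_density[OF f] using D(5) by (intro AE_I2) force
  with no_atom[of 0] show "AE x in D. 0 < x"
    by eventually_elim (use D(4) in force)
qed

theorem lemma5p2:
  fixes n m :: nat and D :: "nat \<Rightarrow> real measure" and \<I> :: "nat set set"
    and A B :: "(nat \<Rightarrow> nat set \<Rightarrow> real) \<Rightarrow> nat \<Rightarrow> nat set"
  assumes "n \<ge> 1" and "m \<ge> 1"
    and "\<And>j. j \<in> {1..m} \<Longrightarrow> regular_distribution (D j)"
    and "downward_closed_system {1..m} \<I>"
    and "\<And>j. j \<in> {1..m} \<Longrightarrow> {j} \<in> \<I>"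
    and "vcg_rule {1..n} {1..m} A"
    and "vcg_rule {1..n + m - 1} {1..m} B"
  shows "expected_vcg_revenue B (n + m - 1) m D (additive_subject_to \<I>)
           \<ge> expected_vcg_revenue A n m D additive_val"
proof (cases "n = 1")
  \<comment> \<open>A lone bidder pays nothing, so the additive revenue is \<open>0\<close>. This
    case is separate because \<open>second_max\<close> needs two bidders.\<close>
  case True
  then show ?thesis by (simp add: expected_vcg_revenue_def vcg_revenue_single_bidder)
next
  case False
  with assms(1) have n: "2 \<le> n" by simp
  let ?N = "{1..n}" and ?K = "{1..n + m - 1}" and ?M = "{1..m}"
  have "1 \<in> ?M" using assms(2) by simp
  \<comment> \<open>The product lemmas ask for a probability measure at every index, so
    \<open>D\<close> is extended beyond the items by \<open>D 1\<close>.\<close>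
  define E where "E j = (if j \<in> ?M then D j else D 1)" for j
  have reg: "regular_distribution (E j)" for j
    using assms(3) \<open>1 \<in> ?M\<close> by (auto simp: E_def)
  note real = regular_distributionD(1)[OF reg] and atomless = regular_distributionD(2)[OF reg]
    and pos = regular_distributionD(3)[OF reg]
  have prob: "prob_space (E j)" for j using real[of j] unfolding real_distribution_def by blast
  have sets: "sets (E j) = sets borel" for j
    using real[of j] by (simp add: real_distribution_def real_distribution_axioms_def)
  define P where "P = PiM ?M E"
  have P: "PiM ?M D = P" unfolding P_def by (rule PiM_cong) (auto simp: E_def)
  have probP: "prob_space P" unfolding P_def by (rule prob_space_PiM) (rule prob)
  interpret market ?K ?M \<I>
    by unfold_locales (use assms(2,4,5) in auto)
  have card: "card ?K + 1 = n + card ?M" "card ?M < card ?K" using assms(1,2) n by auto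
  \<comment> \<open>Column \<open>j\<close> is redrawn from \<open>E j\<close>, after which the
    integrand no longer depends on \<open>v\<close>.\<close>
  have column: "(\<integral>\<^sup>+v. ennreal (second_max ?N (\<lambda>i. v i j)) \<partial>PiM ?N (\<lambda>_. P)) =
      (\<integral>\<^sup>+x. ennreal (second_max ?N x) \<partial>PiM ?N (\<lambda>_. E j))"
    and column_meas: "(\<lambda>v. ennreal (second_max ?N (\<lambda>i. v i j))) \<in> borel_measurable (PiM ?N (\<lambda>_. P))"
    if j: "j \<in> ?M" for j
  proof -
    have "(\<lambda>v. v i j) \<in> borel_measurable (PiM ?N (\<lambda>_. P))" if i: "i \<in> ?N" for i
    proof -
      have "(\<lambda>v. v i j) \<in> PiM ?N (\<lambda>_. P) \<rightarrow>\<^sub>M E j"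
        unfolding P_def
        using measurable_compose[OF measurable_component_singleton[OF i] measurable_component_singleton[OF j]] .
      then show ?thesis using sets by (simp cong: measurable_cong_sets)
    qed
    then show meas: "(\<lambda>v. ennreal (second_max ?N (\<lambda>i. v i j))) \<in> borel_measurable (PiM ?N (\<lambda>_. P))"
      by (intro measurable_compose[OF borel_measurable_second_max measurable_ennreal]) auto
    have "(\<integral>\<^sup>+v. ennreal (second_max ?N (\<lambda>i. v i j)) \<partial>PiM ?N (\<lambda>_. P)) =
      (\<integral>\<^sup>+v. \<integral>\<^sup>+x. ennreal (second_max ?N (\<lambda>i. (\<lambda>i\<in>?N. (v i)(j := x i)) i j)) \<partial>PiM ?N (\<lambda>_. E j) \<partial>PiM ?N (\<lambda>_. P))"
      using nn_integral_PiM_resample[OF prob _ _ j meas[unfolded P_def]] by (simp add: P_def)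
    also have "\<dots> = (\<integral>\<^sup>+v. \<integral>\<^sup>+x. ennreal (second_max ?N x) \<partial>PiM ?N (\<lambda>_. E j) \<partial>PiM ?N (\<lambda>_. P))"
      by (intro nn_integral_cong arg_cong[of _ _ ennreal] second_max_cong) simp
    also have "\<dots> = (\<integral>\<^sup>+x. ennreal (second_max ?N x) \<partial>PiM ?N (\<lambda>_. E j))"
      using prob_space.emeasure_space_1[OF prob_space_PiM[of ?N "\<lambda>_. P", OF probP]] by simp
    finally show "(\<integral>\<^sup>+v. ennreal (second_max ?N (\<lambda>i. v i j)) \<partial>PiM ?N (\<lambda>_. P)) =
      (\<integral>\<^sup>+x. ennreal (second_max ?N x) \<partial>PiM ?N (\<lambda>_. E j))" .
  qed
  have reassigned_meas: "(\<lambda>v. reassigned_value v j) \<in> borel_measurable (PiM ?K (\<lambda>_. P))" if "j \<in> ?M" for j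
    unfolding P_def by (rule measurable_reassigned_value[OF sets that])
  have item: "(\<integral>\<^sup>+x. ennreal (second_max ?N x) \<partial>PiM ?N (\<lambda>_. E j)) \<le>
      (\<integral>\<^sup>+v. ennreal (reassigned_value v j) \<partial>PiM ?K (\<lambda>_. P))" if j: "j \<in> ?M" for j
  proof -
    let ?r = "\<lambda>v x. reassigned_value (\<lambda>i\<in>?K. (v i)(j := x i)) j"
    \<comment> \<open>The constant is averaged over \<open>v\<close>, so that the comparison can be
      made for each fixed choice of the values for the other items.\<close>
    have "(\<integral>\<^sup>+x. ennreal (second_max ?N x) \<partial>PiM ?N (\<lambda>_. E j)) =
        (\<integral>\<^sup>+v. \<integral>\<^sup>+x. ennreal (second_max ?N x) \<partial>PiM ?N (\<lambda>_. E j) \<partial>PiM ?K (\<lambda>_. P))"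
      using prob_space.emeasure_space_1[OF prob_space_PiM[of ?K "\<lambda>_. P", OF probP]] by simp
    also have "\<dots> \<le> (\<integral>\<^sup>+v. \<integral>\<^sup>+x. ennreal (?r v x) \<partial>PiM ?K (\<lambda>_. E j) \<partial>PiM ?K (\<lambda>_. P))"
    proof (rule nn_integral_mono)
      fix v assume v: "v \<in> space (PiM ?K (\<lambda>_. P))"
      \<comment> \<open>\<open>c\<close>, \<open>U\<close> and \<open>R\<close> may depend on
        \<open>v\<close>, but not on the redrawn column \<open>x\<close>.\<close>
      obtain c :: "nat \<Rightarrow> real" and U R where
        U: "U \<subseteq> ?K" "card U = n" and c: "\<And>i. i \<in> ?K \<Longrightarrow> c i \<le> 0" "\<And>i. i \<in> U \<Longrightarrow> c i = 0"
        and R: "\<And>i. i \<in> ?K \<Longrightarrow> R i \<subseteq> ?K - {i}" "\<And>i. i \<in> ?K \<Longrightarrow> card (R i) = card U - 1"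
        and winner: "\<forall>x. (\<forall>i\<in>?K. 0 < x i) \<longrightarrow>
          (\<exists>i\<in>?K. (\<forall>l\<in>?K. x l + c l \<le> x i + c i) \<and> (\<forall>l\<in>R i. x l \<le> ?r v x))"
        by (rule winner_structure[OF j card(1) n, of v]) (rule that)
      show "(\<integral>\<^sup>+x. ennreal (second_max ?N x) \<partial>PiM ?N (\<lambda>_. E j)) \<le>
          (\<integral>\<^sup>+x. ennreal (?r v x) \<partial>PiM ?K (\<lambda>_. E j))"
      proof (rule real_distribution.nn_integral_second_max_le[OF real _ U(1) _ atomless _ _ c R])
        show "?r v \<in> borel_measurable (PiM ?K (\<lambda>_. E j))"
          using measurable_compose[OF measurable_replace_column[OF v[unfolded P_def] j]
              reassigned_meas[OF j, unfolded P_def]] .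
        have "AE x in PiM ?K (\<lambda>_. E j). \<forall>i\<in>?K. 0 < x i"
          by (intro AE_finite_allI AE_PiM_component prob pos) auto
        then show "AE x in PiM ?K (\<lambda>_. E j).
            \<exists>i\<in>?K. (\<forall>l\<in>?K. x l + c l \<le> x i + c i) \<and> (\<forall>l\<in>R i. x l \<le> ?r v x)"
          by eventually_elim (use winner in blast)
      qed (use U(2) n in auto)
    qed
    also have "\<dots> = (\<integral>\<^sup>+v. ennreal (reassigned_value v j) \<partial>PiM ?K (\<lambda>_. P))"
      unfolding P_def
      by (rule nn_integral_PiM_resample[symmetric, OF prob _ _ j])
        (use reassigned_meas[OF j] in \<open>auto simp: P_def\<close>)
    finally show ?thesis .
  qed
  have "expected_vcg_revenue A n m D additive_val \<le>
      (\<integral>\<^sup>+v. (\<Sum>j\<in>?M. ennreal (second_max ?N (\<lambda>i. v i j))) \<partial>PiM ?N (\<lambda>_. P))"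
    unfolding expected_vcg_revenue_def P Let_def
  proof (rule nn_integral_mono_AE)
    have "AE v in PiM ?N (\<lambda>_. P). \<forall>i\<in>?N. \<forall>j\<in>?M. 0 < v i j"
      unfolding P_def by (rule AE_PiM_PiM) (use prob pos in auto)
    then show "AE v in PiM ?N (\<lambda>_. P).
        ennreal (vcg_revenue (\<lambda>i. additive_val (v i)) ?N ?M (A (\<lambda>i. additive_val (v i)))) \<le>
        (\<Sum>j\<in>?M. ennreal (second_max ?N (\<lambda>i. v i j)))"
    proof eventually_elim
      case (elim v)
      have "vcg_revenue (\<lambda>i. additive_val (v i)) ?N ?M (A (\<lambda>i. additive_val (v i))) \<le>
          (\<Sum>j\<in>?M. second_max ?N (\<lambda>i. v i j))"
        by (rule vcg_revenue_additive_le) (use elim n assms(6) in \<open>auto simp: vcg_rule_def intro: less_imp_le\<close>)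
      then show ?case using ennreal_sum_le order_trans ennreal_leI by blast
    qed
  qed
  also have "\<dots> = (\<Sum>j\<in>?M. \<integral>\<^sup>+x. ennreal (second_max ?N x) \<partial>PiM ?N (\<lambda>_. E j))"
    using column column_meas by (subst nn_integral_sum) (auto intro!: sum.cong)
  also have "\<dots> \<le> (\<Sum>j\<in>?M. \<integral>\<^sup>+v. ennreal (reassigned_value v j) \<partial>PiM ?K (\<lambda>_. P))"
    by (intro sum_mono item)
  also have "\<dots> = (\<integral>\<^sup>+v. (\<Sum>j\<in>?M. ennreal (reassigned_value v j)) \<partial>PiM ?K (\<lambda>_. P))"
    by (rule nn_integral_sum[symmetric], rule measurable_compose[OF reassigned_meas measurable_ennreal])
  also have "\<dots> \<le> expected_vcg_revenue B (n + m - 1) m D (additive_subject_to \<I>)"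
    unfolding expected_vcg_revenue_def P Let_def
  proof (rule nn_integral_mono_AE)
    have "AE v in PiM ?K (\<lambda>_. P). \<forall>i\<in>?K. \<forall>j\<in>?M. 0 < v i j"
      unfolding P_def by (rule AE_PiM_PiM) (use prob pos in auto)
    then show "AE v in PiM ?K (\<lambda>_. P). (\<Sum>j\<in>?M. ennreal (reassigned_value v j)) \<le>
        ennreal (vcg_revenue (\<lambda>i. additive_subject_to \<I> (v i)) ?K ?M (B (\<lambda>i. additive_subject_to \<I> (v i))))"
    proof eventually_elim
      case (elim v)
      have "(\<Sum>j\<in>?M. ennreal (reassigned_value v j)) = ennreal (\<Sum>j\<in>?M. reassigned_value v j)"
        by (intro sum_ennreal less_imp_le reassigned_value_pos card) (use elim in auto)
      also have "(\<Sum>j\<in>?M. reassigned_value v j) \<le>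
          vcg_revenue (\<lambda>i. additive_subject_to \<I> (v i)) ?K ?M (B (\<lambda>i. additive_subject_to \<I> (v i)))"
        unfolding reassigned_value_def
        by (rule vcg_revenue_ge_reassign[OF card(2)]) (use elim assms(7) in \<open>auto simp: vcg_rule_def\<close>)
      finally show ?case by (simp add: ennreal_leI)
    qed
  qed
  finally show ?thesis .
qed

end
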